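(* Let $\hat z=(\hat x,\hat y,\hat s)$ be formed by the Dual Gambit Rule from a point $\bar y$ with $\bar\lambda\le\beta<1$, and let $\Delta z=(\Delta x,\Delta y,\Delta s)$ be the corresponding affine-scaling direction. For the points $z(\alpha)=\hat z+\alpha\Delta z$, with $\alpha\ge0$ and $\alpha c_\beta<1$, we have $$\Omega(z(\alpha))\ \le\ \Omega(\hat z)+\alpha c_\beta\beta^2+\omega_*(\alpha c_\beta)-\nu\,\omega_*(\alpha)\ \le\ \Omega(\hat z)-\ln(1-\alpha c_\beta),$$ where $c_\beta=\frac{\sqrt\nu+\beta}{1-\beta}$ and $\omega_*(\tau)=-\tau-\ln(1-\tau)$ for $\tau\in[0,1)$.
   Context: $\mathbb E$ is a finite-dimensional real vector space with dual space $\mathbb E^*$; $\langle s,x\rangle$ is the value of $s\in\mathbb E^*$ at $x\in\mathbb E$. $K\subset\mathbb E$ is a closed convex pointed cone with nonempty interior, $K^*=\{s\in\mathbb E^*:\langle s,x\rangle\ge0\ \forall x\in K\}$. A self-concordant function is a closed convex three times differentiable function $f$ with open domain such that $D^3f(x)[h]^3\le 2(D^2f(x)[h]^2)^{3/2}$. $F$ is a $\nu$-normal (regular) barrier for $K$: a self-concordant function with domain $\mathrm{int}\,K$, tending to $+\infty$ at the boundary, with $F(\tau x)=F(x)-\nu\ln\tau$ for $\tau>0$ ($\nu\ge1$). Its dual barrier is $F_*(s)=\max_{x\in\mathrm{int}\,K}[-\langle s,x\rangle-F(x)]$, $s\in\mathrm{int}\,K^*$. $A:\mathbb E\to\mathbb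 R^m$ is linear with adjoint $A^*:\mathbb R^m\to\mathbb E^*$, $b\in\mathbb R^m\setminus\{0\}$, $c\in\mathbb E^*$; $(A^*,c):\mathbb R^{m+1}\to\mathbb E^*$ is injective, and there exists $(\tilde x,\tilde y,\tilde s)\in\mathrm{int}\,K\times\mathbb R^m\times\mathrm{int}\,K^*$ with $A\tilde x=b$, $\tilde s+A^*\tilde y=c$. ${\cal F}_y=\{y\in\mathbb R^m:c-A^*y\in K^*\}$, $\zeta(y)=F_*(c-A^*y)$, $\psi_t(y)=\zeta(y)-t\langle b,y\rangle$. For $x\in\mathrm{int}\,K$, $s\in\mathrm{int}\,K^*$, the functional proximity measure of $z=(x,y,s)$ with $Ax=b$, $s+A^*y=c$ is $\Omega(z)=\nu\ln\langle s,x\rangle+F(x)+F_*(s)+\nu-\nu\ln\nu$. Dual Gambit Rule. Let $t>0$ and $\bar y\in\mathrm{int}\,{\cal F}_y$ with $\bar\lambda:=\langle\nabla\psi_t(\bar y),[\nabla^2\zeta(\bar y)]^{-1}\nabla\psi_t(\bar y)\rangle^{1/2}\le\beta<1$. Put $\bar d=[\nabla^2\zeta(\bar y)]^{-1}\nabla\psi_t(\bar y)$, $\bar s=c-A^*\bar y$, $\bar x=-\frac1t\nabla F_*(\bar s)$, $\hat y=\bar y+\bar d$, $\hat s=c-A^*\hat y$, $\bar w_*=\sqrt t\,\bar s$, $\hat x=\nabla^2F_*(\bar w_* )\hat s$, $\hat z=(\hat x,\hat y,\hat s)$. Affine-scaling direction. With $\bar w=-\nabla F_*(\bar w_* )=\sqrt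 t\,\bar x$, the direction $\Delta z=(\Delta x,\Delta y,\Delta s)$ is the solution of $\Delta s+\nabla^2F(\bar w)\Delta x=-\hat s$, $A\Delta x=0$, $\Delta s+A^*\Delta y=0$. *)

theory Defs
  imports "HOL-Analysis.Analysis"
begin

text \<open>
  A finite-dimensional real vector space \<open>E\<close> is rendered as a Euclidean space, and its dual
  \<open>E*\<close> is identified with \<open>E\<close> through the inner product (Riesz representation): the value of
  a functional \<open>s\<close> at \<open>x\<close> is \<open>s \<bullet> x\<close>. Gradients are therefore vectors and Hessians
  linear endomorphisms, and the library's \<open>adjoint A\<close> is the adjoint operator into the dual.
\<close>

subsection \<open>Derivatives\<close>

definition grad :: "('a::euclidean_space \<Rightarrow> real) \<Rightarrow> 'a \<Rightarrow> 'a" where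
  "grad f x = (THE g. GDERIV f x :> g)"

definition hess :: "('a::euclidean_space \<Rightarrow> real) \<Rightarrow> 'a \<Rightarrow> 'a \<Rightarrow> 'a" where
  "hess f x = frechet_derivative (grad f) (at x)"

definition third_deriv :: "('a::euclidean_space \<Rightarrow> real) \<Rightarrow> 'a \<Rightarrow> 'a \<Rightarrow> 'a \<Rightarrow> 'a \<Rightarrow> real" where
  "third_deriv f x u v w = frechet_derivative (\<lambda>y. hess f y u \<bullet> v) (at x) w"

text \<open>
  Differentiability of the operator-valued map \<open>y \<mapsto> hess f y\<close> is expressed by
  differentiability of \<open>y \<mapsto> hess f y u\<close> for each \<open>u\<close>; in finite dimension this is the same.
\<close>

definition three_times_differentiable_on ::
    "('a::euclidean_space \<Rightarrow> real) \<Rightarrow> 'a set \<Rightarrow> bool" where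
  "three_times_differentiable_on f Q \<longleftrightarrow>
     (\<forall>x\<in>Q. f differentiable (at x) \<and> grad f differentiable (at x) \<and>
            (\<forall>u. (\<lambda>y. hess f y u) differentiable (at x)))"

subsection \<open>Self-concordant functions and normal barriers\<close>

text \<open>
  A function with domain \<open>Q\<close> is a total function whose values outside \<open>Q\<close> are irrelevant.
  It is closed when its epigraph over \<open>Q\<close> is a closed set.
\<close>

definition self_concordant_on :: "'a::euclidean_space set \<Rightarrow> ('a \<Rightarrow> real) \<Rightarrow> bool" where
  "self_concordant_on Q f \<longleftrightarrow>
     open Q \<and> convex_on Q f \<and> closed (epigraph Q f) \<and> three_times_differentiable_on f Q \<and>
     (\<forall>x\<in>Q. \<forall>h. third_deriv f x h h h \<le> 2 * (hess f x h \<bullet> h) powr (3 / 2))"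

definition normal_barrier :: "real \<Rightarrow> 'a::euclidean_space set \<Rightarrow> ('a \<Rightarrow> real) \<Rightarrow> bool" where
  "normal_barrier \<nu> K F \<longleftrightarrow>
     \<nu> \<ge> 1 \<and> self_concordant_on (interior K) F \<and>
     (\<forall>x\<in>frontier K. filterlim F at_top (at x within interior K)) \<and>
     (\<forall>x\<in>interior K. \<forall>\<tau>>0. F (\<tau> *\<^sub>R x) = F x - \<nu> * ln \<tau>)"

definition dual_cone :: "'a::euclidean_space set \<Rightarrow> 'a set" where
  "dual_cone K = {s. \<forall>x\<in>K. s \<bullet> x \<ge> 0}"

text \<open>Only meaningful for \<open>s \<in> interior (dual_cone K)\<close>, where the supremum is a maximum.\<close>

definition dual_barrier :: "'a::euclidean_space set \<Rightarrow> ('a \<Rightarrow> real) \<Rightarrow> 'a \<Rightarrow> real" where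
  "dual_barrier K F s = (SUP x\<in>interior K. - (s \<bullet> x) - F x)"

subsection \<open>The primal-dual conic problem\<close>

definition strictly_feasible ::
    "'a::euclidean_space set \<Rightarrow> ('a \<Rightarrow> real^'m) \<Rightarrow> real^'m \<Rightarrow> 'a \<Rightarrow> 'a \<times> (real^'m) \<times> 'a \<Rightarrow> bool" where
  "strictly_feasible K A b c = (\<lambda>(x, y, s).
     x \<in> interior K \<and> s \<in> interior (dual_cone K) \<and> A x = b \<and> s + adjoint A y = c)"

definition dual_feasible_set ::
    "'a::euclidean_space set \<Rightarrow> ('a \<Rightarrow> real^'m) \<Rightarrow> 'a \<Rightarrow> (real^'m) set" where
  "dual_feasible_set K A c = {y. c - adjoint A y \<in> dual_cone K}"

definition dual_barrier_y ::
    "'a::euclidean_space set \<Rightarrow> ('a \<Rightarrow> real) \<Rightarrow> ('a \<Rightarrow> real^'m) \<Rightarrow> 'a \<Rightarrow> real^'m \<Rightarrow> real" where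
  "dual_barrier_y K F A c y = dual_barrier K F (c - adjoint A y)"

definition dual_potential ::
    "'a::euclidean_space set \<Rightarrow> ('a \<Rightarrow> real) \<Rightarrow> ('a \<Rightarrow> real^'m) \<Rightarrow> real^'m \<Rightarrow> 'a \<Rightarrow> real \<Rightarrow>
     real^'m \<Rightarrow> real" where
  "dual_potential K F A b c t y = dual_barrier_y K F A c y - t * (b \<bullet> y)"

definition proximity ::
    "real \<Rightarrow> 'a::euclidean_space set \<Rightarrow> ('a \<Rightarrow> real) \<Rightarrow> 'a \<times> (real^'m) \<times> 'a \<Rightarrow> real" where
  "proximity \<nu> K F = (\<lambda>(x, y, s).
     \<nu> * ln (s \<bullet> x) + F x + dual_barrier K F s + \<nu> - \<nu> * ln \<nu>)"

definition omega_star :: "real \<Rightarrow> real" where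
  "omega_star \<tau> = - \<tau> - ln (1 - \<tau>)"

definition affine_scaling_direction ::
    "('a::euclidean_space \<Rightarrow> real) \<Rightarrow> ('a \<Rightarrow> real^'m) \<Rightarrow> 'a \<Rightarrow> 'a \<Rightarrow>
     'a \<times> (real^'m) \<times> 'a \<Rightarrow> bool" where
  "affine_scaling_direction F A w s = (\<lambda>(dx, dy, ds).
     ds + hess F w dx = - s \<and> A dx = 0 \<and> ds + adjoint A dy = 0)"

end

theory Submission
  imports Defs
begin

text \<open>
  Write \<open>\<parallel>h\<parallel>\<^sub>x\<close> for the norm given by the Hessian of a self-concordant function at \<open>x\<close>. Put
  \<open>s = c - A* ybar\<close> and let \<open>x\<close> be the point of \<open>int K\<close> with \<open>\<nabla>F x = - s\<close>, so that
  \<open>\<nabla>F\<^sub>* s = - x\<close> and \<open>N = \<nabla>\<^sup>2F\<^sub>* s\<close> is the inverse of \<open>M = \<nabla>\<^sup>2F x\<close>. By logarithmic homogeneity the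
  proximity measure does not change when the primal point is multiplied by \<open>t\<close>. After that scaling
  the dual gambit rule reads \<open>shat = s + \<delta>\<close>, \<open>xhat = N shat = x + N \<delta>\<close> with
  \<open>\<parallel>\<delta>\<parallel>\<^sub>s = \<parallel>N \<delta>\<parallel>\<^sub>x = lam\<close>, and the affine-scaling direction \<open>(U, V)\<close> satisfies
  \<open>V + M U = - shat\<close> and \<open>\<langle>V, U\<rangle> = 0\<close>.

  Orthogonality has two consequences. The inner product \<open>\<langle>s, x\<rangle>\<close> decreases exactly by the factor
  \<open>1 - \<alpha>\<close>, which accounts for \<open>\<nu> ln (1 - \<alpha>)\<close>; and
  \<open>\<parallel>U\<parallel>\<^sub>x\<^sup>2 + \<parallel>V\<parallel>\<^sub>s\<^sup>2 = \<parallel>shat\<parallel>\<^sub>s\<^sup>2 \<le> (\<surd>\<nu> + lam)\<^sup>2\<close>. Moving from \<open>(x, s)\<close> to \<open>(xhat, shat)\<close> enlarges the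
  local norms by at most the factor \<open>1 / (1 - lam)\<close>, so the joint local norm of the direction at \<open>(xhat, shat)\<close>
  is at most \<open>c\<^sub>\<beta>\<close>. The self-concordant upper bound then gives the term \<open>\<omega>\<^sub>*(\<alpha> c\<^sub>\<beta>)\<close> and feasibility
  of the whole step.

  What is left is the slope: \<open>\<langle>\<nabla>F xhat, U\<rangle> + \<langle>\<nabla>F\<^sub>* shat, V\<rangle> \<le> \<nu> + c\<^sub>\<beta> \<beta>\<^sup>2\<close>. Bounding the linearization
  errors of the two gradients against \<open>U\<close> and \<open>V\<close> separately loses a factor \<open>\<surd>2\<close>. Instead, with
  \<open>q = N V - U\<close>, one has \<open>2 U = - xhat - q\<close> and \<open>2 V = - shat + M q\<close>. The Euler identities
  \<open>\<langle>\<nabla>F xhat, xhat\<rangle> = \<langle>\<nabla>F\<^sub>* shat, shat\<rangle> = - \<nu>\<close> produce exactly \<open>\<nu>\<close>, and in the remaining difference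
  \<open>\<langle>\<nabla>F xhat, q\<rangle> - \<langle>\<nabla>F\<^sub>* shat, M q\<rangle>\<close> the first-order parts cancel. Only the two errors of size
  \<open>lam\<^sup>2 / (1 - lam) * \<parallel>q\<parallel>\<close> survive, and \<open>\<parallel>q\<parallel> = \<parallel>shat\<parallel>\<^sub>s\<close> by orthogonality again. This is
  \<open>affine_scaling_slope\<close>; \<open>affine_scaling_step\<close> collects the estimates.

  The estimates on \<open>F\<close> and \<open>F\<^sub>*\<close> come from one locale, \<open>self_concordant_field\<close>, which asks for a
  positive definite Hessian whose quadratic forms satisfy
  \<open>\<bar>D(\<nabla>\<^sup>2f(x)[h, h])[w]\<bar> \<le> 2 \<parallel>w\<parallel>\<^sub>x \<parallel>h\<parallel>\<^sub>x\<^sup>2\<close>. For \<open>F\<close> this needs the passage from the diagonal to the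
  mixed third derivative (\<open>symmetric_trilinear_diagonal_bound\<close>) and the absence of lines in \<open>K\<close>
  (\<open>sc_degenerate_direction\<close>). For \<open>F\<^sub>*\<close> it follows by differentiating the inverse of the map
  \<open>(x, v) \<mapsto> (- \<nabla>F x, \<nabla>\<^sup>2F x v)\<close> (\<open>dual_hess_form_deriv\<close>).
\<close>

section \<open>Norms given by positive definite operators\<close>

definition pos_def_op :: "('a::euclidean_space \<Rightarrow> 'a) \<Rightarrow> bool" where
  "pos_def_op M \<longleftrightarrow> linear M \<and> (\<forall>u v. M u \<bullet> v = u \<bullet> M v) \<and> (\<forall>h. h \<noteq> 0 \<longrightarrow> M h \<bullet> h > 0)"

definition local_norm :: "('a::euclidean_space \<Rightarrow> 'a) \<Rightarrow> 'a \<Rightarrow> real" where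
  "local_norm M h = sqrt (M h \<bullet> h)"

lemma pos_def_op_linear: "pos_def_op M \<Longrightarrow> linear M"
  and pos_def_op_sym: "pos_def_op M \<Longrightarrow> M u \<bullet> v = u \<bullet> M v"
  and pos_def_op_pos: "pos_def_op M \<Longrightarrow> h \<noteq> 0 \<Longrightarrow> M h \<bullet> h > 0"
  by (auto simp: pos_def_op_def)

lemma pos_def_op_nonneg: "pos_def_op M \<Longrightarrow> M h \<bullet> h \<ge> 0"
  by (cases "h = 0") (auto dest: pos_def_op_pos[of M h] simp: linear_0 pos_def_op_linear)

lemma local_norm_nonneg: "pos_def_op M \<Longrightarrow> local_norm M h \<ge> 0"
  by (simp add: local_norm_def pos_def_op_nonneg)

lemma local_norm_square: "pos_def_op M \<Longrightarrow> (local_norm M h)\<^sup>2 = M h \<bullet> h"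
  by (simp add: local_norm_def pos_def_op_nonneg)

lemma local_norm_pos: "pos_def_op M \<Longrightarrow> h \<noteq> 0 \<Longrightarrow> local_norm M h > 0"
  by (simp add: local_norm_def pos_def_op_pos)

lemma local_norm_zero: "pos_def_op M \<Longrightarrow> local_norm M 0 = 0"
  by (simp add: local_norm_def)

lemma local_norm_scaleR: "pos_def_op M \<Longrightarrow> local_norm M (a *\<^sub>R h) = \<bar>a\<bar> * local_norm M h"
  by (simp add: local_norm_def linear_cmul[OF pos_def_op_linear] real_sqrt_mult flip: mult.assoc)

lemma local_norm_minus: "pos_def_op M \<Longrightarrow> local_norm M (- h) = local_norm M h"
  using local_norm_scaleR[of M "-1" h] by simp

text \<open>
  By the polarization identity a symmetric form is half the difference of its values at sum and
  difference, and the parallelogram law for \<open>M\<close> recombines the two bounds. Rescaling \<open>u\<close> and \<open>v\<close> to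
  equal local norm makes the result sharp.
\<close>

lemma form_le_of_diagonal:
  assumes M: "pos_def_op M" and D: "linear D" "\<And>u v. D u \<bullet> v = u \<bullet> D v"
    and diag: "\<And>h. \<bar>D h \<bullet> h\<bar> \<le> \<kappa> * (M h \<bullet> h)"
  shows "\<bar>D u \<bullet> v\<bar> \<le> \<kappa> * local_norm M u * local_norm M v"
proof (cases "u = 0 \<or> v = 0")
  case True
  then show ?thesis by (auto simp: linear_0[OF D(1)] local_norm_zero[OF M])
next
  case False
  define a where "a = local_norm M u"
  define b where "b = local_norm M v"
  have ab: "a > 0" "b > 0" using False local_norm_pos[OF M] by (auto simp: a_def b_def)
  define p where "p = b *\<^sub>R u"
  define q where "q = a *\<^sub>R v"
  note lM = pos_def_op_linear[OF M]
  have "D p \<bullet> q = D q \<bullet> p" using D(2)[of p q] by (simp add: inner_commute)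
  then have 1: "4 * (D p \<bullet> q) = D (p + q) \<bullet> (p + q) - D (p - q) \<bullet> (p - q)"
    by (simp add: linear_add[OF D(1)] linear_diff[OF D(1)] inner_add_left inner_add_right
        inner_diff_left inner_diff_right)
  have 2: "M (p + q) \<bullet> (p + q) + M (p - q) \<bullet> (p - q) = 2 * (M p \<bullet> p) + 2 * (M q \<bullet> q)"
    by (simp add: linear_add[OF lM] linear_diff[OF lM] inner_add_left inner_add_right
        inner_diff_left inner_diff_right)
  have 3: "M p \<bullet> p = a\<^sup>2 * b\<^sup>2" "M q \<bullet> q = a\<^sup>2 * b\<^sup>2"
    using local_norm_square[OF M, of u] local_norm_square[OF M, of v]
    by (simp_all add: p_def q_def linear_cmul[OF lM] a_def b_def power2_eq_square)
  have "\<bar>4 * (D p \<bullet> q)\<bar> \<le> \<kappa> * (M (p + q) \<bullet> (p + q)) + \<kappa> * (M (p - q) \<bullet> (p - q))"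
    unfolding 1 using diag[of "p+q"] diag[of "p-q"] by linarith
  also have "\<dots> = 4 * (\<kappa> * (a\<^sup>2 * b\<^sup>2))"
    unfolding distrib_left[symmetric] 2 3 by simp
  finally have "\<bar>D p \<bullet> q\<bar> \<le> \<kappa> * (a\<^sup>2 * b\<^sup>2)" by simp
  moreover have "D p \<bullet> q = (a * b) * (D u \<bullet> v)"
    by (simp add: p_def q_def linear_cmul[OF D(1)])
  ultimately have "(a * b) * \<bar>D u \<bullet> v\<bar> \<le> (a * b) * (\<kappa> * a * b)"
    using ab by (simp add: abs_mult power2_eq_square algebra_simps)
  then show ?thesis using ab by (simp add: a_def b_def)
qed

lemma local_norm_Cauchy_Schwarz:
  assumes "pos_def_op M"
  shows "\<bar>M u \<bullet> v\<bar> \<le> local_norm M u * local_norm M v"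
proof -
  have "\<bar>M h \<bullet> h\<bar> \<le> 1 * (M h \<bullet> h)" for h
    using pos_def_op_nonneg[OF assms, of h] by simp
  from form_le_of_diagonal[OF assms pos_def_op_linear[OF assms] pos_def_op_sym[OF assms] this]
  show ?thesis by simp
qed

lemma local_norm_triangle:
  assumes "pos_def_op M"
  shows "local_norm M (u + v) \<le> local_norm M u + local_norm M v"
proof (rule power2_le_imp_le)
  have "M v \<bullet> u = M u \<bullet> v" by (metis assms inner_commute pos_def_op_sym)
  then show "(local_norm M (u + v))\<^sup>2 \<le> (local_norm M u + local_norm M v)\<^sup>2"
    using local_norm_Cauchy_Schwarz[OF assms, of u v]
    by (simp add: power2_sum local_norm_square[OF assms] linear_add[OF pos_def_op_linear[OF assms]]
        inner_add_left inner_add_right)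
qed (simp add: assms local_norm_nonneg)

text \<open>
  Comparison of the local norm with the Euclidean one: the minimum over the compact unit sphere is
  positive.
\<close>

lemma pos_def_op_lower_bound:
  assumes M: "pos_def_op M"
  shows "\<exists>m>0. \<forall>h. m * norm h \<le> local_norm M h"
proof (cases "\<exists>h::'a. h \<noteq> 0")
  case False
  then show ?thesis by (intro exI[of _ 1]) (auto simp: local_norm_nonneg[OF M])
next
  case True
  then obtain h0 :: 'a where "h0 \<noteq> 0" by auto
  have "sphere 0 1 \<noteq> ({} :: 'a set)"
    using \<open>h0 \<noteq> 0\<close> by (auto simp: set_eq_iff intro!: exI[of _ "sgn h0"] simp: norm_sgn)
  moreover have "continuous_on (sphere 0 1) (local_norm M)"
    unfolding local_norm_def using linear_continuous_on[OF linear_conv_bounded_linear[THEN iffD1,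
      OF pos_def_op_linear[OF M]]] by (intro continuous_intros)
  ultimately obtain z where z: "z \<in> sphere 0 1" "\<And>h. h \<in> sphere 0 1 \<Longrightarrow> local_norm M z \<le> local_norm M h"
    using continuous_attains_inf[OF compact_sphere] by metis
  have "local_norm M z * norm h \<le> local_norm M h" for h
  proof (cases "h = 0")
    case False
    have "local_norm M z \<le> local_norm M ((1 / norm h) *\<^sub>R h)"
      using False by (intro z) auto
    also have "\<dots> = local_norm M h / norm h" by (simp add: local_norm_scaleR[OF M])
    finally show ?thesis using False by (simp add: pos_le_divide_eq)
  qed (simp add: local_norm_nonneg[OF M])
  moreover have "local_norm M z > 0" using z(1) by (intro local_norm_pos[OF M]) auto
  ultimately show ?thesis by blast
qed

lemma pos_def_op_bij:
  assumes M: "pos_def_op M" shows "bij M"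
proof -
  have "inj M" unfolding linear_injective_0[OF pos_def_op_linear[OF M]]
    using pos_def_op_pos[OF M] by force
  then show ?thesis
    using linear_injective_imp_surjective[OF pos_def_op_linear[OF M]] by (simp add: bij_def)
qed

lemma pos_def_op_inv:
  assumes M: "pos_def_op M"
  shows "M (inv M u) = u" "inv M (M u) = u" "pos_def_op (inv M)"
    and "local_norm (inv M) (M u) = local_norm M u"
proof -
  have inj: "inj M" and surj: "surj M" using pos_def_op_bij[OF M] by (auto simp: bij_def)
  show 1: "M (inv M u) = u" for u using surj by (simp add: surj_f_inv_f)
  show 2: "inv M (M u) = u" for u using inj by simp
  have sym: "inv M u \<bullet> v = u \<bullet> inv M v" for u v
    using pos_def_op_sym[OF M, of "inv M u" "inv M v"] by (simp add: 1)
  have "linear (inv M)"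
    using inj_linear_imp_inv_linear[OF pos_def_op_linear[OF M] inj] .
  moreover have "inv M h \<bullet> h > 0" if "h \<noteq> 0" for h
  proof -
    have "inv M h \<noteq> 0" using that 1[of h] by (metis linear_0 M pos_def_op_linear)
    from pos_def_op_pos[OF M this] show ?thesis by (simp add: 1 inner_commute)
  qed
  ultimately show "pos_def_op (inv M)" using sym by (auto simp: pos_def_op_def)
  show "local_norm (inv M) (M u) = local_norm M u"
    by (simp add: local_norm_def 2 inner_commute)
qed

lemma pos_def_op_unit_sphere_compact:
  assumes M: "pos_def_op M"
  shows "compact {h. local_norm M h = 1}"
proof -
  obtain m where m: "m > 0" "\<And>h. m * norm h \<le> local_norm M h"
    using pos_def_op_lower_bound[OF M] by auto
  have cont: "continuous_on UNIV (local_norm M)"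
    unfolding local_norm_def using linear_continuous_on[OF linear_conv_bounded_linear[THEN iffD1,
      OF pos_def_op_linear[OF M]]] by (intro continuous_intros)
  have "norm h \<le> 1 / m" if "local_norm M h = 1" for h
    using m that by (metis mult.commute pos_le_divide_eq)
  then have "bounded {h. local_norm M h = 1}" by (auto simp: bounded_iff)
  moreover have "closed {h. local_norm M h = 1}"
    using continuous_closed_preimage_constant[OF cont, of 1] by simp
  ultimately show ?thesis by (simp add: compact_eq_bounded_closed)
qed

section \<open>Symmetric trilinear forms\<close>

text \<open>
  Banach's theorem that a symmetric trilinear form has its norm on the diagonal. Among the pairs of
  unit vectors \<open>(u, v)\<close> that maximize \<open>T u v v\<close>, take one with the largest \<open>\<langle>M u, v\<rangle>\<close>. If \<open>u \<noteq> v\<close>, the form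
  \<open>T v\<close> also attains its norm at the normalized sum of \<open>u\<close> and \<open>v\<close>, and that vector encloses with
  \<open>v\<close> only half the angle that \<open>u\<close> did.
\<close>

lemma symmetric_trilinear_diagonal_bound:
  fixes T :: "'a::euclidean_space \<Rightarrow> 'a \<Rightarrow> 'a \<Rightarrow> real"
  assumes M: "pos_def_op M"
    and lin: "\<And>u v. linear (\<lambda>w. T w u v)"
    and sym12: "\<And>u v w. T u v w = T v u w" and sym23: "\<And>u v w. T u v w = T u w v"
    and diag: "\<And>h. \<bar>T h h h\<bar> \<le> C * (local_norm M h) ^ 3"
  shows "\<bar>T w h h\<bar> \<le> C * local_norm M w * (local_norm M h)\<^sup>2"
proof -
  let ?S = "{h. local_norm M h = 1}"
  let ?b = "\<lambda>w h. M w \<bullet> h"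
  note lM = pos_def_op_linear[OF M]
  have lin2: "linear (\<lambda>w. T u w v)" for u v using lin[of u v] by (simp add: sym12[of u])
  have lin3: "linear (\<lambda>w. T u v w)" for u v using lin2[of u v] by (simp add: sym23[of u v])
  note exp = linear_add[OF lin] linear_add[OF lin2] linear_add[OF lin3]
    linear_diff[OF lin] linear_diff[OF lin2] linear_diff[OF lin3]
    linear_cmul[OF lin] linear_cmul[OF lin2] linear_cmul[OF lin3]
    linear_0[OF lin] linear_0[OF lin2] linear_0[OF lin3]
    linear_neg[OF lin] linear_neg[OF lin2] linear_neg[OF lin3]
  have main: "T w h h \<le> C" if wh: "w \<in> ?S" "h \<in> ?S" for w h
  proof -
    have comp: "compact (?S \<times> ?S)"
      by (intro compact_Times pos_def_op_unit_sphere_compact[OF M])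
    have contT: "continuous_on UNIV (\<lambda>p. T (fst p) (snd p) (snd p))"
    proof -
      have e: "T w h h = (\<Sum>i\<in>Basis. (w \<bullet> i) * T i h h)" for w h
      proof -
        have "T w h h = T (\<Sum>i\<in>Basis. (w \<bullet> i) *\<^sub>R i) h h" by (simp add: euclidean_representation)
        also have "\<dots> = (\<Sum>i\<in>Basis. (w \<bullet> i) * T i h h)"
          by (simp add: linear_sum[OF lin] exp)
        finally show ?thesis .
      qed
      have "bounded_bilinear (\<lambda>u v. T i u v)" for i
        unfolding bilinear_conv_bounded_bilinear[symmetric] bilinear_def using lin2 lin3 by blast
      then have "continuous_on UNIV (\<lambda>p. T i (snd p) (snd p))" for i
        by (rule bounded_bilinear.continuous_on) (intro continuous_intros)+
      then show ?thesis by (subst e) (intro continuous_intros)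
    qed
    have ne: "?S \<times> ?S \<noteq> {}" using wh by auto
    from continuous_attains_sup[OF comp ne continuous_on_subset[OF contT subset_UNIV]]
    obtain p where p: "p \<in> ?S \<times> ?S"
        "\<forall>q\<in>?S \<times> ?S. T (fst q) (snd q) (snd q) \<le> T (fst p) (snd p) (snd p)"
      by (elim bexE)
    define R where "R = T (fst p) (snd p) (snd p)"
    have R: "T u v v \<le> R" if "u \<in> ?S" "v \<in> ?S" for u v
      using bspec[OF p(2), of "(u, v)"] that by (simp add: R_def)
    have R0: "R \<ge> 0"
    proof -
      have "T w h h \<le> R" "T (- w) h h \<le> R" using wh by (auto intro!: R simp: local_norm_minus[OF M])
      then show ?thesis unfolding linear_neg[OF lin] by linarith
    qed
    let ?E = "(?S \<times> ?S) \<inter> (\<lambda>p. T (fst p) (snd p) (snd p)) -` {R}"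
    have "closed ((\<lambda>p. T (fst p) (snd p) (snd p)) -` {R})"
      by (rule closed_vimage[OF closed_singleton contT])
    then have c1: "compact ?E" using comp by (intro compact_Int_closed)
    have c2: "?E \<noteq> {}" using p(1) by (auto simp: R_def)
    have c3: "continuous_on ?E (\<lambda>p. ?b (fst p) (snd p))"
      using linear_continuous_on_compose[OF continuous_on_fst[OF continuous_on_id] lM]
      by (intro continuous_on_inner continuous_on_snd continuous_on_id)
    from continuous_attains_sup[OF c1 c2 c3] obtain e where e0: "e \<in> ?E"
      "\<forall>q\<in>?E. ?b (fst q) (snd q) \<le> ?b (fst e) (snd e)" by (elim bexE)
    have e: "e \<in> ?E" "\<And>q. q \<in> ?E \<Longrightarrow> ?b (fst q) (snd q) \<le> ?b (fst e) (snd e)"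
      using e0(1) bspec[OF e0(2)] by this
    obtain u v where uv: "e = (u, v)" by (cases e)
    have u1: "local_norm M u = 1" and v1: "local_norm M v = 1" and TR: "T u v v = R"
      using e(1) uv by auto
    define \<gamma> where "\<gamma> = ?b u v"
    have Muu: "?b u u = 1" and Mvv: "?b v v = 1"
      using local_norm_square[OF M, of u] local_norm_square[OF M, of v] u1 v1 by auto
    have Mvu: "?b v u = \<gamma>" using pos_def_op_sym[OF M, of u v] by (simp add: \<gamma>_def inner_commute)
    (* The value of T u v v does not change under v to -v, so the largest value of \<gamma> is nonnegative. *)
    have g0: "\<gamma> \<ge> 0"
    proof -
      have "(u, -v) \<in> ?E" using TR u1 v1
        by (simp add: local_norm_minus[OF M] linear_neg[OF lin2] linear_neg[OF lin3])
      from e(2)[OF this] show ?thesis by (simp add: uv \<gamma>_def)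
    qed
    have g1: "\<gamma> \<le> 1" using local_norm_Cauchy_Schwarz[OF M, of u v] u1 v1 by (simp add: \<gamma>_def)
    have scaled: "T v k k \<le> R * ?b k k \<and> - T v k k \<le> R * ?b k k" for k
    proof (cases "k = 0")
      case False
      define l where "l = local_norm M k"
      have l: "l > 0" using local_norm_pos[OF M False] by (simp add: l_def)
      define k1 where "k1 = (1 / l) *\<^sub>R k"
      have k1: "k1 \<in> ?S" using l by (simp add: k1_def local_norm_scaleR[OF M] l_def)
      have "T v k k = l\<^sup>2 * T v k1 k1" using l by (simp add: k1_def exp power2_eq_square)
      moreover have "?b k k = l\<^sup>2" using local_norm_square[OF M, of k] by (simp add: l_def)
      moreover have "T v k1 k1 \<le> R" using R k1 v1 by simp
      moreover have "- T v k1 k1 \<le> R"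
        using R[of "-v" k1] k1 v1 by (simp add: local_norm_minus[OF M] linear_neg[OF lin])
      ultimately show ?thesis using l
        by (metis minus_mult_right mult.commute mult_left_mono zero_le_power2)
    qed (simp add: exp linear_0[OF lM])
    have Tv: "T v u v = R" "T v v u = R" using TR sym12[of u v v] sym23[of v u v] by auto
    have bd: "?b (u + v) (u + v) = 2 + 2 * \<gamma>" "?b (u - v) (u - v) = 2 - 2 * \<gamma>"
      using Muu Mvv Mvu
      by (simp_all add: linear_add[OF lM] linear_diff[OF lM] inner_add_left inner_add_right
          inner_diff_left inner_diff_right \<gamma>_def)
    have "T v (u - v) (u - v) = T v u u + T v v v - 2 * R"
      using Tv by (simp add: exp)
    then have "T v u u + T v v v \<ge> 2 * R * \<gamma>"
      using scaled[of "u - v"] unfolding bd by (simp only: right_diff_distrib) linarith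
    moreover have "T v (u + v) (u + v) = T v u u + T v v v + 2 * R"
      using Tv by (simp add: exp)
    (* The lower bound at u - v forces the value at u + v up to the norm of T v, so that the norm is
       attained there. *)
    ultimately have att: "T v (u + v) (u + v) = R * (2 + 2 * \<gamma>)"
      using scaled[of "u + v"] unfolding bd by (simp only: distrib_left) linarith
    define l where "l = local_norm M (u + v)"
    have l2: "l\<^sup>2 = 2 + 2 * \<gamma>" using local_norm_square[OF M, of "u+v"] bd by (simp add: l_def)
    have l: "l > 0"
    proof -
      have "l \<ge> 0" by (simp add: l_def local_norm_nonneg[OF M])
      moreover have "l \<noteq> 0" using l2 g0 by auto
      ultimately show ?thesis by simp
    qed
    define k where "k = (1 / l) *\<^sub>R (u + v)"
    have "local_norm M k = 1" using l by (simp add: k_def local_norm_scaleR[OF M] l_def)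
    moreover have "T v k k = T v (u + v) (u + v) / l\<^sup>2"
      unfolding k_def linear_cmul[OF lin2] linear_cmul[OF lin3] by (simp add: power2_eq_square)
    then have "T v k k = R"
      using att l l2 g0 by (simp only:) (simp add: field_simps)
    ultimately have "(v, k) \<in> ?E" using v1 by auto
    from e(2)[OF this] have "?b v k \<le> \<gamma>" by (simp add: uv \<gamma>_def)
    moreover have "?b v k = (1 + \<gamma>) / l" using Mvv Mvu by (simp add: k_def inner_add_right)
    ultimately have "1 + \<gamma> \<le> \<gamma> * l" using l by (simp add: field_simps)
    then have "(1 + \<gamma>)\<^sup>2 \<le> (\<gamma> * l)\<^sup>2" using g0 by (intro power_mono) auto
    also have "\<dots> = 2 * \<gamma>\<^sup>2 * (1 + \<gamma>)" using l2 by (simp add: power_mult_distrib algebra_simps)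
    finally have "(1 + \<gamma>) * (1 + \<gamma>) \<le> (1 + \<gamma>) * (2 * \<gamma>\<^sup>2)"
      by (simp add: power2_eq_square algebra_simps)
    then have "1 + \<gamma> \<le> 2 * \<gamma>\<^sup>2" using g0 by simp
    moreover have "\<gamma>\<^sup>2 \<le> \<gamma>" using g0 g1 by (simp add: power2_eq_square mult_left_le)
    ultimately have "\<gamma> = 1" using g1 by simp
    then have "?b (u - v) (u - v) = 0" using bd by simp
    then have "u = v" using pos_def_op_pos[OF M, of "u - v"] by force
    then have "R \<le> C" using TR diag[of u] u1 by simp
    then show "T w h h \<le> C" using R[OF wh] by simp
  qed
  show ?thesis
  proof (cases "w = 0 \<or> h = 0")
    case True
    then show ?thesis by (auto simp: exp local_norm_zero[OF M])
  next
    case False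
    define a b where "a = local_norm M w" and "b = local_norm M h"
    have ab: "a > 0" "b > 0" using False local_norm_pos[OF M] by (auto simp: a_def b_def)
    define w1 h1 where "w1 = (1 / a) *\<^sub>R w" and "h1 = (1 / b) *\<^sub>R h"
    have S: "w1 \<in> ?S" "- w1 \<in> ?S" "h1 \<in> ?S"
      using ab
      by (simp_all add: w1_def h1_def local_norm_minus[OF M] local_norm_scaleR[OF M] a_def b_def)
    have "T (- w1) h1 h1 = - T w1 h1 h1" by (rule linear_neg[OF lin])
    then have "\<bar>T w1 h1 h1\<bar> \<le> C" using main[OF S(1,3)] main[OF S(2,3)] by linarith
    moreover have "T w h h = a * b\<^sup>2 * T w1 h1 h1"
      using ab by (simp add: w1_def h1_def exp power2_eq_square)
    ultimately show ?thesis using ab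
      by (simp add: abs_mult a_def[symmetric] b_def[symmetric] mult.commute mult_left_mono)
  qed
qed

section \<open>Symmetry of second derivatives\<close>

lemma has_real_derivative_along_line:
  fixes f :: "'a::euclidean_space \<Rightarrow> real"
  assumes "(f has_derivative f') (at (x + \<theta> *\<^sub>R v))"
  shows "((\<lambda>\<theta>. f (x + \<theta> *\<^sub>R v)) has_real_derivative f' v) (at \<theta>)"
proof -
  have "((\<lambda>\<theta>. x + \<theta> *\<^sub>R v) has_derivative (\<lambda>t. t *\<^sub>R v)) (at \<theta>)"
    by (auto intro!: derivative_eq_intros)
  from has_derivative_compose[OF this assms]
  have "((\<lambda>\<theta>. f (x + \<theta> *\<^sub>R v)) has_derivative (\<lambda>t. f' (t *\<^sub>R v))) (at \<theta>)" .
  moreover have "(\<lambda>t. f' (t *\<^sub>R v)) = (*) (f' v)"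
    using linear_cmul[OF has_derivative_linear[OF assms]] by (auto simp: mult.commute)
  ultimately show ?thesis by (simp add: has_field_derivative_def)
qed

text \<open>
  The mean value theorem in the direction \<open>v\<close> turns the second difference into an increment of the
  gradient over \<open>t u\<close>, which differentiability of \<open>g\<close> at the single point \<open>x\<close> controls. A limit at a
  single point is what the third derivative of a self-concordant function calls for, since it exists
  everywhere but may be discontinuous.
\<close>

lemma second_difference_limit:
  fixes f :: "'a::euclidean_space \<Rightarrow> real"
  assumes "open S" "x \<in> S" and f: "\<And>y. y \<in> S \<Longrightarrow> (f has_derivative (\<lambda>h. g y \<bullet> h)) (at y)"
    and g: "(g has_derivative g') (at x)"
  shows "((\<lambda>t. (f (x + t *\<^sub>R u + t *\<^sub>R v) - f (x + t *\<^sub>R u) - f (x + t *\<^sub>R v) + f x) / t\<^sup>2)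
    \<longlongrightarrow> g' u \<bullet> v) (at_right 0)"
proof (rule tendstoI)
  fix e :: real assume e: "e > 0"
  define n where "n = norm u + norm v + 1"
  have n: "n > 0" "norm u + norm v \<le> n" by (auto simp: n_def add_nonneg_pos)
  define k where "k = e / (4 * n * n)"
  have k: "k > 0" using e n by (simp add: k_def)
  note lg = has_derivative_linear[OF g]
  from g[unfolded has_derivative_at_alt] k obtain d1 where d1: "d1 > 0"
    "\<And>y. norm (y - x) < d1 \<Longrightarrow> norm (g y - g x - g' (y - x)) \<le> k * norm (y - x)"
    by blast
  obtain d2 where d2: "d2 > 0" "ball x d2 \<subseteq> S" using assms(1,2) openE by blast
  (* For t below this bound the parallelogram spanned by t u and t v stays within d1 and d2 of x,
     and k is small enough to leave an error of e / 2. *)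
  define d where "d = min d1 d2 / n"
  have d: "d > 0" using d1 d2 n by (simp add: d_def)
  have est: "dist ((f (x + t *\<^sub>R u + t *\<^sub>R v) - f (x + t *\<^sub>R u) - f (x + t *\<^sub>R v) + f x) / t\<^sup>2) (g' u \<bullet> v) < e"
    if t: "0 < t" "t < d" for t
  proof -
    have tn: "t * n < d1" "t * n < d2" using t n by (simp_all add: d_def field_simps)
    have nu: "norm (a *\<^sub>R u + b *\<^sub>R v) \<le> t * n" if "\<bar>a\<bar> \<le> t" "\<bar>b\<bar> \<le> t" for a b
    proof -
      have "norm (a *\<^sub>R u + b *\<^sub>R v) \<le> \<bar>a\<bar> * norm u + \<bar>b\<bar> * norm v"
        by (metis norm_scaleR norm_triangle_ineq)
      also have "\<dots> \<le> t * norm u + t * norm v" using that by (intro add_mono mult_right_mono) auto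
      also have "\<dots> \<le> t * n" using n t by (metis distrib_left mult_left_mono less_imp_le)
      finally show ?thesis .
    qed
    have inS: "x + a *\<^sub>R u + b *\<^sub>R v \<in> S" if "\<bar>a\<bar> \<le> t" "\<bar>b\<bar> \<le> t" for a b
    proof -
      have "dist x (x + (a *\<^sub>R u + b *\<^sub>R v)) \<le> t * n"
        using nu[OF that] by (subst dist_commute) (simp only: dist_norm add_diff_cancel_left')
      then show ?thesis using tn d2 by (auto simp: add.assoc)
    qed
    define \<phi> where "\<phi> = (\<lambda>\<theta>. f (x + t *\<^sub>R u + \<theta> *\<^sub>R v) - f (x + \<theta> *\<^sub>R v))"
    have "\<exists>z. 0 < z \<and> z < t \<and> \<phi> t - \<phi> 0 = (t - 0) * (g (x + t *\<^sub>R u + z *\<^sub>R v) \<bullet> v - g (x + z *\<^sub>R v) \<bullet> v)"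
    proof (rule MVT2)
      fix z assume z: "0 \<le> z" "z \<le> t"
      have "x + t *\<^sub>R u + z *\<^sub>R v \<in> S" "x + z *\<^sub>R v \<in> S"
        using inS[of t z] inS[of 0 z] z t by auto
      then show "(\<phi> has_real_derivative (g (x + t *\<^sub>R u + z *\<^sub>R v) \<bullet> v - g (x + z *\<^sub>R v) \<bullet> v)) (at z)"
        unfolding \<phi>_def by (intro DERIV_diff has_real_derivative_along_line f)
    qed (use t in auto)
    then obtain z where z: "0 < z" "z < t"
      and mv: "\<phi> t - \<phi> 0 = t * ((g (x + t *\<^sub>R u + z *\<^sub>R v) - g (x + z *\<^sub>R v)) \<bullet> v)"
      by (auto simp: inner_diff_left)
    define E where "E = (\<lambda>y. g y - g x - g' (y - x))"
    have E1: "norm (E (x + t *\<^sub>R u + z *\<^sub>R v)) \<le> k * (t * n)"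
    proof -
      have "norm (x + t *\<^sub>R u + z *\<^sub>R v - x) \<le> t * n" using nu[of t z] z t by (simp add: add.assoc)
      then show ?thesis using d1(2)[of "x + t *\<^sub>R u + z *\<^sub>R v"] tn k
        by (auto simp: E_def intro: order_trans mult_left_mono)
    qed
    have E2: "norm (E (x + z *\<^sub>R v)) \<le> k * (t * n)"
    proof -
      have "norm (x + z *\<^sub>R v - x) \<le> t * n" using nu[of 0 z] z t by simp
      then show ?thesis using d1(2)[of "x + z *\<^sub>R v"] tn k
        by (auto simp: E_def intro: order_trans mult_left_mono)
    qed
    have "g (x + t *\<^sub>R u + z *\<^sub>R v) - g (x + z *\<^sub>R v) = t *\<^sub>R g' u + (E (x + t *\<^sub>R u + z *\<^sub>R v) - E (x + z *\<^sub>R v))"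
      by (simp add: E_def linear_add[OF lg] linear_cmul[OF lg] add.assoc)
    then have "\<phi> t - \<phi> 0 = t * (t * (g' u \<bullet> v) + (E (x + t *\<^sub>R u + z *\<^sub>R v) - E (x + z *\<^sub>R v)) \<bullet> v)"
      unfolding mv by (simp only: inner_add_left inner_scaleR_left)
    then have "\<phi> t - \<phi> 0 - t\<^sup>2 * (g' u \<bullet> v) = t * ((E (x + t *\<^sub>R u + z *\<^sub>R v) - E (x + z *\<^sub>R v)) \<bullet> v)"
      by (simp only: distrib_left power2_eq_square mult.assoc add_diff_cancel_left')
    also have "\<bar>\<dots>\<bar> \<le> t * ((2 * (k * (t * n))) * n)"
    proof -
      have "\<bar>(E (x + t *\<^sub>R u + z *\<^sub>R v) - E (x + z *\<^sub>R v)) \<bullet> v\<bar>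
          \<le> norm (E (x + t *\<^sub>R u + z *\<^sub>R v) - E (x + z *\<^sub>R v)) * norm v"
        by (rule Cauchy_Schwarz_ineq2)
      also have "\<dots> \<le> (2 * (k * (t * n))) * n"
      proof (rule mult_mono)
        show "norm (E (x + t *\<^sub>R u + z *\<^sub>R v) - E (x + z *\<^sub>R v)) \<le> 2 * (k * (t * n))"
          using E1 E2 norm_triangle_ineq4[of "E (x + t *\<^sub>R u + z *\<^sub>R v)" "E (x + z *\<^sub>R v)"] by linarith
      qed (use n k t in \<open>auto simp: n_def\<close>)
      finally show ?thesis using t by (simp add: abs_mult)
    qed
    also have "\<dots> = t\<^sup>2 * (e / 2)" using n by (simp add: k_def power2_eq_square field_simps)
    finally have "\<bar>\<phi> t - \<phi> 0 - t\<^sup>2 * (g' u \<bullet> v)\<bar> \<le> t\<^sup>2 * (e / 2)" .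
    moreover have "dist ((\<phi> t - \<phi> 0) / t\<^sup>2) (g' u \<bullet> v) = \<bar>\<phi> t - \<phi> 0 - t\<^sup>2 * (g' u \<bullet> v)\<bar> / t\<^sup>2"
    proof -
      have "(\<phi> t - \<phi> 0) / t\<^sup>2 - g' u \<bullet> v = (\<phi> t - \<phi> 0 - t\<^sup>2 * (g' u \<bullet> v)) / t\<^sup>2"
        using t by (simp add: field_simps)
      then show ?thesis by (simp add: dist_real_def)
    qed
    ultimately have "dist ((\<phi> t - \<phi> 0) / t\<^sup>2) (g' u \<bullet> v) \<le> e / 2"
      using t by (simp add: pos_divide_le_eq mult.commute)
    moreover have "\<phi> t - \<phi> 0 = f (x + t *\<^sub>R u + t *\<^sub>R v) - f (x + t *\<^sub>R u) - f (x + t *\<^sub>R v) + f x"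
      by (simp add: \<phi>_def)
    ultimately show ?thesis using e by simp
  qed
  show "\<forall>\<^sub>F t in at_right 0. dist ((f (x + t *\<^sub>R u + t *\<^sub>R v) - f (x + t *\<^sub>R u) - f (x + t *\<^sub>R v) + f x) / t\<^sup>2) (g' u \<bullet> v) < e"
    unfolding eventually_at_right_field using est d by auto
qed

lemma second_derivative_symmetric:
  fixes f :: "'a::euclidean_space \<Rightarrow> real"
  assumes "open S" "x \<in> S" "\<And>y. y \<in> S \<Longrightarrow> (f has_derivative (\<lambda>h. g y \<bullet> h)) (at y)"
    "(g has_derivative g') (at x)"
  shows "g' u \<bullet> v = g' v \<bullet> u"
proof -
  have "((\<lambda>t. (f (x + t *\<^sub>R u + t *\<^sub>R v) - f (x + t *\<^sub>R u) - f (x + t *\<^sub>R v) + f x) / t\<^sup>2)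
    \<longlongrightarrow> g' v \<bullet> u) (at_right 0)"
    using second_difference_limit[OF assms, of v u] by (simp add: algebra_simps)
  with second_difference_limit[OF assms, of u v] show ?thesis
    using tendsto_unique[of "at_right (0::real)"] by force
qed

section \<open>The function omega-star\<close>

lemma omega_star_deriv:
  assumes "\<tau> < 1" shows "(omega_star has_real_derivative \<tau> / (1 - \<tau>)) (at \<tau>)"
proof -
  have "((\<lambda>\<tau>. - \<tau> - ln (1 - \<tau>)) has_real_derivative - 1 - (0 - 1) / (1 - \<tau>)) (at \<tau>)"
    using assms by (auto intro!: derivative_eq_intros)
  moreover have "- 1 - (0 - 1) / (1 - \<tau>) = \<tau> / (1 - \<tau>)" using assms by (simp add: field_simps)
  ultimately show ?thesis unfolding omega_star_def[abs_def] by simp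
qed

lemma omega_star_nonneg: "\<tau> < 1 \<Longrightarrow> omega_star \<tau> \<ge> 0"
  using ln_le_minus_one[of "1 - \<tau>"] by (simp add: omega_star_def)

lemma omega_star_zero [simp]: "omega_star 0 = 0"
  by (simp add: omega_star_def)

lemma omega_star_scaled_deriv:
  assumes "\<theta> * r < 1"
  shows "((\<lambda>\<theta>. omega_star (\<theta> * r)) has_real_derivative \<theta> * r\<^sup>2 / (1 - \<theta> * r)) (at \<theta>)"
proof -
  have "((\<lambda>\<theta>. \<theta> * r) has_real_derivative r) (at \<theta>)" by (auto intro!: derivative_eq_intros)
  from DERIV_chain2[OF omega_star_deriv[OF assms] this]
  show ?thesis by (simp add: power2_eq_square mult.assoc)
qed

text \<open>
  Lets the bounds for the primal and the dual step be added as if the sum of the two barriers were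
  a single self-concordant function: the derivative of \<open>\<theta> \<mapsto> \<omega>\<^sub>*(\<theta> a)\<close> is \<open>\<theta> a\<^sup>2 / (1 - \<theta> a)\<close>, and
  raising the \<open>a\<close> in its denominator to \<open>r\<close> makes the derivatives add up.
\<close>

lemma omega_star_superadditive:
  assumes "a \<ge> 0" "b \<ge> 0" "r \<ge> 0" "a\<^sup>2 + b\<^sup>2 \<le> r\<^sup>2" "r < 1"
  shows "omega_star a + omega_star b \<le> omega_star r"
proof -
  have "a\<^sup>2 \<le> r\<^sup>2" "b\<^sup>2 \<le> r\<^sup>2"
    using assms(4) zero_le_power2[of a] zero_le_power2[of b] by linarith+
  then have ar: "a \<le> r" "b \<le> r" using assms(3) power2_le_imp_le by blast+
  have lt: "\<theta> * s < 1" if "0 \<le> \<theta>" "\<theta> \<le> 1" "0 \<le> s" "s \<le> r" for \<theta> s :: real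
    using mult_mono[of \<theta> 1 s r] that assms by simp
  let ?F = "\<lambda>\<theta>. omega_star (\<theta> * r) - omega_star (\<theta> * a) - omega_star (\<theta> * b)"
  have "?F 0 \<le> ?F 1"
  proof (rule DERIV_nonneg_imp_nondecreasing[where f = ?F])
    fix \<theta> :: real assume \<theta>: "0 \<le> \<theta>" "\<theta> \<le> 1"
    have l: "\<theta> * r < 1" "\<theta> * a < 1" "\<theta> * b < 1" using lt \<theta> assms ar by auto
    have le: "\<theta> * s\<^sup>2 / (1 - \<theta> * s) \<le> \<theta> * s\<^sup>2 / (1 - \<theta> * r)" if "s \<le> r" for s
      using l(1) that \<theta> by (intro divide_left_mono mult_pos_pos) (auto simp: mult_left_mono intro: le_less_trans[OF mult_left_mono])
    have "\<theta> * a\<^sup>2 / (1 - \<theta> * r) + \<theta> * b\<^sup>2 / (1 - \<theta> * r) = \<theta> * (a\<^sup>2 + b\<^sup>2) / (1 - \<theta> * r)"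
      by (simp add: add_divide_distrib distrib_left)
    also have "\<dots> \<le> \<theta> * r\<^sup>2 / (1 - \<theta> * r)"
      using l(1) \<theta> assms by (intro divide_right_mono mult_left_mono) auto
    finally have "\<theta> * r\<^sup>2 / (1 - \<theta> * r) - \<theta> * a\<^sup>2 / (1 - \<theta> * a) - \<theta> * b\<^sup>2 / (1 - \<theta> * b) \<ge> 0"
      using le[OF ar(1)] le[OF ar(2)] by linarith
    moreover have "(?F has_real_derivative \<theta> * r\<^sup>2 / (1 - \<theta> * r) - \<theta> * a\<^sup>2 / (1 - \<theta> * a) - \<theta> * b\<^sup>2 / (1 - \<theta> * b)) (at \<theta>)"
      by (intro DERIV_diff omega_star_scaled_deriv l)
    ultimately show "\<exists>y. (?F has_real_derivative y) (at \<theta>) \<and> y \<ge> 0" by blast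
  qed simp
  then show ?thesis by simp
qed

section \<open>Self-concordant calculus\<close>

text \<open>
  The gradient and the Hessian are parameters so that the same estimates apply to a barrier and to
  its dual, whose derivatives are known by formulas. The last assumption is the mixed form of
  self-concordance, expressed through quadratic forms of the Hessian only, so that no third
  derivative has to be named for the dual barrier.
\<close>

locale self_concordant_field =
  fixes Q :: "'a::euclidean_space set" and f :: "'a \<Rightarrow> real" and g :: "'a \<Rightarrow> 'a"
    and H :: "'a \<Rightarrow> 'a \<Rightarrow> 'a"
  assumes open_Q: "open Q" and convex_Q: "convex Q"
    and f_deriv: "x \<in> Q \<Longrightarrow> (f has_derivative (\<lambda>h. g x \<bullet> h)) (at x)"
    and g_deriv: "x \<in> Q \<Longrightarrow> (g has_derivative H x) (at x)"
    and H_pos: "x \<in> Q \<Longrightarrow> pos_def_op (H x)"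
    and third: "x \<in> Q \<Longrightarrow> \<exists>D. ((\<lambda>y. H y h \<bullet> h) has_derivative D) (at x) \<and>
      (\<forall>w. \<bar>D w\<bar> \<le> 2 * local_norm (H x) w * (H x h \<bullet> h))"
begin

lemma segment_in_Q:
  assumes "x \<in> Q" "x + v \<in> Q" "0 \<le> \<theta>" "\<theta> \<le> 1"
  shows "x + \<theta> *\<^sub>R v \<in> Q"
proof -
  have "(1 - \<theta>) *\<^sub>R x + \<theta> *\<^sub>R (x + v) \<in> Q"
    using convex_Q assms by (simp add: convex_alt)
  then show ?thesis by (simp add: algebra_simps)
qed

lemma hessian_form_deriv_along_line:
  assumes "x + \<theta> *\<^sub>R v \<in> Q"
  shows "\<exists>d. ((\<lambda>\<theta>. H (x + \<theta> *\<^sub>R v) h \<bullet> h) has_real_derivative d) (at \<theta>) \<and>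
    \<bar>d\<bar> \<le> 2 * local_norm (H (x + \<theta> *\<^sub>R v)) v * (H (x + \<theta> *\<^sub>R v) h \<bullet> h)"
  using third[OF assms, of h] has_real_derivative_along_line by blast

lemma gradient_deriv_along_line:
  assumes "x + \<theta> *\<^sub>R v \<in> Q"
  shows "((\<lambda>\<theta>. g (x + \<theta> *\<^sub>R v) \<bullet> h) has_real_derivative H (x + \<theta> *\<^sub>R v) v \<bullet> h) (at \<theta>)"
  by (rule has_real_derivative_along_line[of "\<lambda>y. g y \<bullet> h" "\<lambda>w. H (x + \<theta> *\<^sub>R v) w \<bullet> h"])
    (intro has_derivative_inner_left g_deriv assms)

lemma gradient_inj_on: "inj_on g Q"
proof (rule inj_onI, rule ccontr)
  fix x y assume xy: "x \<in> Q" "y \<in> Q" "g x = g y" "x \<noteq> y"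
  define v where "v = y - x"
  have "\<exists>z. 0 < z \<and> z < 1 \<and> g (x + 1 *\<^sub>R v) \<bullet> v - g (x + 0 *\<^sub>R v) \<bullet> v = (1 - 0) * (H (x + z *\<^sub>R v) v \<bullet> v)"
    using xy by (intro MVT2 gradient_deriv_along_line segment_in_Q) (auto simp: v_def)
  then obtain z where z: "0 < z" "z < 1" "H (x + z *\<^sub>R v) v \<bullet> v = 0"
    using xy by (auto simp: v_def)
  have "x + z *\<^sub>R v \<in> Q" using xy z by (intro segment_in_Q) (auto simp: v_def)
  from pos_def_op_pos[OF H_pos[OF this], of v] z xy show False by (simp add: v_def)
qed

text \<open>
  Along the line the function \<open>\<theta> \<mapsto> 1 / \<parallel>v\<parallel>\<close>, with the norm taken at \<open>x + \<theta> v\<close>, is 1-Lipschitz; this is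
  what the constant 2 in the definition of self-concordance is made for.
\<close>

lemma norm_along_line:
  assumes line: "\<And>\<theta>. 0 \<le> \<theta> \<Longrightarrow> \<theta> \<le> T \<Longrightarrow> x + \<theta> *\<^sub>R v \<in> Q" and T: "0 \<le> T"
  defines "r \<equiv> local_norm (H x) v"
  shows "r \<le> local_norm (H (x + T *\<^sub>R v)) v * (1 + T * r)"
    and "local_norm (H (x + T *\<^sub>R v)) v * (1 - T * r) \<le> r"
proof -
  have "r \<le> local_norm (H (x + T *\<^sub>R v)) v * (1 + T * r) \<and>
      local_norm (H (x + T *\<^sub>R v)) v * (1 - T * r) \<le> r"
  proof (cases "v = 0")
    case True
    have "x \<in> Q" using line[of 0] T by simp
    then show ?thesis using True local_norm_zero[OF H_pos] by (simp add: r_def)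
  next
    case False
    define p where "p = (\<lambda>\<theta>. H (x + \<theta> *\<^sub>R v) v \<bullet> v)"
    define s where "s = (\<lambda>\<theta>. inverse (sqrt (p \<theta>)))"
    have p: "p \<theta> > 0" if "0 \<le> \<theta>" "\<theta> \<le> T" for \<theta>
      using pos_def_op_pos[OF H_pos[OF line[OF that]] False] by (simp add: p_def)
    have s': "\<exists>d. (s has_real_derivative d) (at \<theta>) \<and> \<bar>d\<bar> \<le> 1" if \<theta>: "0 \<le> \<theta>" "\<theta> \<le> T" for \<theta>
    proof -
      have norm: "local_norm (H (x + \<theta> *\<^sub>R v)) v = sqrt (p \<theta>)" by (simp add: local_norm_def p_def)
      from hessian_form_deriv_along_line[OF line[OF \<theta>], of v] obtain d where
        d: "(p has_real_derivative d) (at \<theta>)" "\<bar>d\<bar> \<le> 2 * sqrt (p \<theta>) * p \<theta>"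
        unfolding norm p_def by blast
      have "((\<lambda>\<theta>. inverse (sqrt (p \<theta>))) has_real_derivative
          - (inverse (sqrt (p \<theta>)) * (d * (inverse (sqrt (p \<theta>)) / 2)) * inverse (sqrt (p \<theta>)))) (at \<theta>)"
        using p[OF \<theta>] by (auto intro!: derivative_eq_intros d(1))
      moreover have "\<bar>- (inverse (sqrt (p \<theta>)) * (d * (inverse (sqrt (p \<theta>)) / 2)) * inverse (sqrt (p \<theta>)))\<bar> \<le> 1"
      proof -
        have sp: "sqrt (p \<theta>) > 0" using p[OF \<theta>] by simp
        have "\<bar>- (inverse (sqrt (p \<theta>)) * (d * (inverse (sqrt (p \<theta>)) / 2)) * inverse (sqrt (p \<theta>)))\<bar>
          = \<bar>d\<bar> / (2 * sqrt (p \<theta>) * (sqrt (p \<theta>) * sqrt (p \<theta>)))"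
          using sp by (simp add: abs_mult field_simps del: real_sqrt_mult_self)
        also have "\<dots> \<le> 1" using d(2) p[OF \<theta>] by (simp add: divide_le_eq)
        finally show ?thesis .
      qed
      ultimately show ?thesis unfolding s_def by blast
    qed
    have up: "s 0 + 0 \<le> s T + T"
    proof (rule DERIV_nonneg_imp_nondecreasing[OF T])
      fix \<theta> assume "0 \<le> \<theta>" "\<theta> \<le> T"
      from s'[OF this] obtain d where "(s has_real_derivative d) (at \<theta>)" "\<bar>d\<bar> \<le> 1" by blast
      then show "\<exists>y. ((\<lambda>\<theta>. s \<theta> + \<theta>) has_real_derivative y) (at \<theta>) \<and> y \<ge> 0"
        by (intro exI[of _ "d + 1"]) (auto intro!: derivative_eq_intros)
    qed
    have down: "s T - T \<le> s 0 - 0"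
    proof (rule DERIV_nonpos_imp_nonincreasing[OF T])
      fix \<theta> assume "0 \<le> \<theta>" "\<theta> \<le> T"
      from s'[OF this] obtain d where "(s has_real_derivative d) (at \<theta>)" "\<bar>d\<bar> \<le> 1" by blast
      then show "\<exists>y. ((\<lambda>\<theta>. s \<theta> - \<theta>) has_real_derivative y) (at \<theta>) \<and> y \<le> 0"
        by (intro exI[of _ "d - 1"]) (auto intro!: derivative_eq_intros)
    qed
    define R where "R = local_norm (H (x + T *\<^sub>R v)) v"
    have "sqrt (p 0) = r" "sqrt (p T) = R" by (simp_all add: p_def r_def R_def local_norm_def)
    then have "s 0 = 1 / r" "s T = 1 / R" "r > 0" "R > 0"
      using p[of 0] p[of T] T by (auto simp: s_def inverse_eq_divide)
    with up down show ?thesis unfolding R_def[symmetric] by (simp add: field_simps)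
  qed
  then show "r \<le> local_norm (H (x + T *\<^sub>R v)) v * (1 + T * r)"
    and "local_norm (H (x + T *\<^sub>R v)) v * (1 - T * r) \<le> r" by auto
qed

text \<open>
  The logarithmic derivative of \<open>e(\<theta>) = \<langle>H(x + \<theta> v) h, h\<rangle>\<close> is at most \<open>2 \<parallel>v\<parallel> \<le> 2 r / (1 - \<theta> r)\<close> in absolute
  value, hence \<open>e / (1 - \<theta> r)\<^sup>2\<close> increases and \<open>e * (1 - \<theta> r)\<^sup>2\<close> decreases.
\<close>

lemma hessian_comparison:
  assumes x: "x \<in> Q" "x + v \<in> Q" and r: "local_norm (H x) v < 1"
  defines "r \<equiv> local_norm (H x) v"
  shows "(1 - r)\<^sup>2 * (H x h \<bullet> h) \<le> H (x + v) h \<bullet> h"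
    and "H (x + v) h \<bullet> h \<le> (H x h \<bullet> h) / (1 - r)\<^sup>2"
proof -
  have r0: "r \<ge> 0" "r < 1" using local_norm_nonneg[OF H_pos[OF x(1)]] r by (auto simp: r_def)
  define e where "e = (\<lambda>\<theta>. H (x + \<theta> *\<^sub>R v) h \<bullet> h)"
  have pos: "1 - \<theta> * r > 0" if "0 \<le> \<theta>" "\<theta> \<le> 1" for \<theta>
    using mult_left_le_one_le[of r \<theta>] that r0 by simp
  have e': "\<exists>d. (e has_real_derivative d) (at \<theta>) \<and> \<bar>d\<bar> * (1 - \<theta> * r) \<le> 2 * r * e \<theta>" if \<theta>: "0 \<le> \<theta>" "\<theta> \<le> 1" for \<theta>
  proof -
    note in_Q = segment_in_Q[OF x \<theta>]
    from hessian_form_deriv_along_line[OF in_Q, of h] obtain d where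
      d: "(e has_real_derivative d) (at \<theta>)" "\<bar>d\<bar> \<le> 2 * local_norm (H (x + \<theta> *\<^sub>R v)) v * e \<theta>"
      unfolding e_def by blast
    have e0: "e \<theta> \<ge> 0" unfolding e_def by (rule pos_def_op_nonneg[OF H_pos[OF in_Q]])
    have n: "local_norm (H (x + \<theta> *\<^sub>R v)) v * (1 - \<theta> * r) \<le> r"
      unfolding r_def by (rule norm_along_line(2)) (use \<theta> x in \<open>auto intro: segment_in_Q\<close>)
    have "\<bar>d\<bar> * (1 - \<theta> * r) \<le> 2 * local_norm (H (x + \<theta> *\<^sub>R v)) v * e \<theta> * (1 - \<theta> * r)"
      using d(2) pos[OF \<theta>] by (intro mult_right_mono) auto
    also have "\<dots> = 2 * e \<theta> * (local_norm (H (x + \<theta> *\<^sub>R v)) v * (1 - \<theta> * r))" by simp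
    also have "\<dots> \<le> 2 * e \<theta> * r" using n e0 by (intro mult_left_mono) auto
    finally show ?thesis using d(1) by (auto simp: mult.commute mult.left_commute)
  qed
  have "e 0 / (1 - 0 * r)\<^sup>2 \<le> e 1 / (1 - 1 * r)\<^sup>2"
  proof (rule DERIV_nonneg_imp_nondecreasing[where f = "\<lambda>\<theta>. e \<theta> / (1 - \<theta> * r)\<^sup>2"])
    fix \<theta> :: real assume \<theta>: "0 \<le> \<theta>" "\<theta> \<le> 1"
    from e'[OF this] obtain d where d: "(e has_real_derivative d) (at \<theta>)"
      "\<bar>d\<bar> * (1 - \<theta> * r) \<le> 2 * r * e \<theta>" by blast
    let ?p = "1 - \<theta> * r"
    have "((\<lambda>\<theta>. e \<theta> / (1 - \<theta> * r)\<^sup>2) has_real_derivative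
        (d * ?p\<^sup>2 - e \<theta> * (2 * (- r * ?p))) / (?p\<^sup>2 * ?p\<^sup>2)) (at \<theta>)"
      using pos[OF \<theta>] by (auto intro!: derivative_eq_intros d(1) simp: power2_eq_square)
    moreover have "(d * ?p\<^sup>2 - e \<theta> * (2 * (- r * ?p))) \<ge> 0"
    proof -
      have "d * ?p\<^sup>2 - e \<theta> * (2 * (- r * ?p)) = ?p * (d * ?p + 2 * r * e \<theta>)"
        by (simp add: power2_eq_square algebra_simps)
      moreover have "d * ?p + 2 * r * e \<theta> \<ge> 0"
      proof -
        have "- d * ?p \<le> \<bar>d\<bar> * ?p" using pos[OF \<theta>] by (intro mult_right_mono) auto
        then show ?thesis using d(2) by simp
      qed
      ultimately show ?thesis using pos[OF \<theta>] by simp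
    qed
    ultimately show "\<exists>y. ((\<lambda>\<theta>. e \<theta> / (1 - \<theta> * r)\<^sup>2) has_real_derivative y) (at \<theta>) \<and> y \<ge> 0"
      by (meson divide_nonneg_nonneg mult_nonneg_nonneg zero_le_power2)
  qed simp
  then show "(1 - r)\<^sup>2 * (H x h \<bullet> h) \<le> H (x + v) h \<bullet> h"
    using r0 by (simp add: e_def pos_le_divide_eq mult.commute)
  have "e 1 * (1 - 1 * r)\<^sup>2 \<le> e 0 * (1 - 0 * r)\<^sup>2"
  proof (rule DERIV_nonpos_imp_nonincreasing[where f = "\<lambda>\<theta>. e \<theta> * (1 - \<theta> * r)\<^sup>2"])
    fix \<theta> :: real assume \<theta>: "0 \<le> \<theta>" "\<theta> \<le> 1"
    from e'[OF this] obtain d where d: "(e has_real_derivative d) (at \<theta>)"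
      "\<bar>d\<bar> * (1 - \<theta> * r) \<le> 2 * r * e \<theta>" by blast
    let ?p = "1 - \<theta> * r"
    have "((\<lambda>\<theta>. e \<theta> * (1 - \<theta> * r)\<^sup>2) has_real_derivative ?p * (d * ?p - 2 * r * e \<theta>)) (at \<theta>)"
      by (auto intro!: derivative_eq_intros d(1) simp: power2_eq_square algebra_simps)
    moreover have "d * ?p - 2 * r * e \<theta> \<le> 0"
    proof -
      have "d * ?p \<le> \<bar>d\<bar> * ?p" using pos[OF \<theta>] by (intro mult_right_mono) auto
      then show ?thesis using d(2) by simp
    qed
    ultimately show "\<exists>y. ((\<lambda>\<theta>. e \<theta> * (1 - \<theta> * r)\<^sup>2) has_real_derivative y) (at \<theta>) \<and> y \<le> 0"
      using pos[OF \<theta>] by (meson less_imp_le mult_nonneg_nonpos)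
  qed simp
  then show "H (x + v) h \<bullet> h \<le> (H x h \<bullet> h) / (1 - r)\<^sup>2"
    using r0 by (simp add: e_def pos_le_divide_eq mult.commute)
qed

lemma local_norm_comparison:
  assumes "x \<in> Q" "x + v \<in> Q" "local_norm (H x) v < 1"
  shows "local_norm (H (x + v)) h \<le> local_norm (H x) h / (1 - local_norm (H x) v)"
proof -
  have "local_norm (H (x + v)) h \<le> sqrt ((H x h \<bullet> h) / (1 - local_norm (H x) v)\<^sup>2)"
    unfolding local_norm_def[of "H (x + v)"] using hessian_comparison(2)[OF assms] by simp
  also have "\<dots> = local_norm (H x) h / (1 - local_norm (H x) v)"
    using assms(3) by (simp add: real_sqrt_divide local_norm_def)
  finally show ?thesis .
qed

text \<open>
  The error is the integral of \<open>H(x + \<theta> v) - H x\<close> applied to \<open>v\<close>. Hessian comparison bounds this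
  difference on the diagonal by \<open>1 / (1 - \<theta> r)\<^sup>2 - 1\<close> times \<open>H x\<close>, hence also as a bilinear form, and
  integration over \<open>[0, 1]\<close> gives \<open>r\<^sup>2 / (1 - r)\<close>.
\<close>

lemma gradient_linearization_error:
  assumes x: "x \<in> Q" "x + v \<in> Q" and r: "local_norm (H x) v < 1"
  defines "r \<equiv> local_norm (H x) v"
  shows "\<bar>(g (x + v) - g x - H x v) \<bullet> h\<bar> \<le> r\<^sup>2 / (1 - r) * local_norm (H x) h"
proof -
  have r0: "r \<ge> 0" "r < 1" using local_norm_nonneg[OF H_pos[OF x(1)]] r by (auto simp: r_def)
  have one: "(g (x + v) - g x - H x v) \<bullet> k \<le> r\<^sup>2 / (1 - r) * local_norm (H x) k" for k
  proof -
    define n where "n = local_norm (H x) k"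
    let ?F = "\<lambda>\<theta>. n * (1 / (1 - \<theta> * r) - \<theta> * r) - (g (x + \<theta> *\<^sub>R v) \<bullet> k - \<theta> * (H x v \<bullet> k))"
    have "?F 0 \<le> ?F 1"
    proof (rule DERIV_nonneg_imp_nondecreasing[where f = ?F])
      fix \<theta> :: real assume \<theta>: "0 \<le> \<theta>" "\<theta> \<le> 1"
      let ?p = "1 - \<theta> * r"
      note in_Q = segment_in_Q[OF x \<theta>]
      have tr: "local_norm (H x) (\<theta> *\<^sub>R v) = \<theta> * r"
        using \<theta> by (simp add: local_norm_scaleR[OF H_pos[OF x(1)]] r_def)
      have p: "?p > 0" "?p \<le> 1" using mult_left_le_one_le[of r \<theta>] \<theta> r0 by auto
      have lt: "local_norm (H x) (\<theta> *\<^sub>R v) < 1" using p by (simp add: tr)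
      let ?y = "x + \<theta> *\<^sub>R v"
      let ?D = "\<lambda>u. H ?y u - H x u"
      let ?\<kappa> = "1 / ?p\<^sup>2 - 1"
      have lin: "linear (H ?y)" "linear (H x)" using H_pos in_Q x by (auto intro: pos_def_op_linear)
      have "\<bar>?D v \<bullet> k\<bar> \<le> ?\<kappa> * local_norm (H x) v * local_norm (H x) k"
      proof (rule form_le_of_diagonal[OF H_pos[OF x(1)], where D = ?D])
        show "linear ?D" by (intro linear_compose_sub lin)
        show "?D a \<bullet> b = a \<bullet> ?D b" for a b
          using pos_def_op_sym[OF H_pos[OF in_Q]] pos_def_op_sym[OF H_pos[OF x(1)]]
          by (simp add: inner_diff_left inner_diff_right)
        fix a
        define q where "q = H x a \<bullet> a"
        have q: "q \<ge> 0" by (simp add: q_def pos_def_op_nonneg[OF H_pos[OF x(1)]])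
        have "H ?y a \<bullet> a \<le> q / ?p\<^sup>2" "?p\<^sup>2 * q \<le> H ?y a \<bullet> a"
          using hessian_comparison[OF x(1) in_Q lt, of a] by (simp_all add: tr q_def)
        (* The lower deviation of the Hessian is the smaller one, because P^2 + 1 / P^2 is at least 2. *)
        moreover have "q - ?p\<^sup>2 * q \<le> q / ?p\<^sup>2 - q"
        proof -
          define P where "P = ?p"
          have P: "P > 0" using p by (simp add: P_def)
          have "0 \<le> (P - 1 / P)\<^sup>2" by simp
          also have "\<dots> = P\<^sup>2 + 1 / P\<^sup>2 - 2" using P by (simp add: power2_diff power_divide)
          finally have "q * (P\<^sup>2 + 1 / P\<^sup>2 - 2) \<ge> 0" using q by simp
          then have "q - P\<^sup>2 * q \<le> q / P\<^sup>2 - q" by (simp add: algebra_simps)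
          then show ?thesis by (simp add: P_def)
        qed
        ultimately have "\<bar>H ?y a \<bullet> a - q\<bar> \<le> q / ?p\<^sup>2 - q" by linarith
        then show "\<bar>?D a \<bullet> a\<bar> \<le> ?\<kappa> * (H x a \<bullet> a)"
          by (simp add: inner_diff_left q_def[symmetric] algebra_simps)
      qed
      then have le: "H ?y v \<bullet> k - H x v \<bullet> k \<le> n * (r / ?p\<^sup>2 - r)"
        by (simp add: inner_diff_left n_def r_def algebra_simps)
      have "(?F has_real_derivative n * (r / ?p\<^sup>2 - r) - (H ?y v \<bullet> k - H x v \<bullet> k)) (at \<theta>)"
        using p by (auto intro!: derivative_eq_intros gradient_deriv_along_line in_Q simp: power2_eq_square)
      then show "\<exists>y. (?F has_real_derivative y) (at \<theta>) \<and> y \<ge> 0" using le by (intro exI conjI) auto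
    qed simp
    then have "(g (x + v) - g x - H x v) \<bullet> k \<le> n * (1 / (1 - r) - 1 - r)"
      by (simp add: inner_diff_left algebra_simps)
    also have "1 / (1 - r) - 1 - r = r\<^sup>2 / (1 - r)" using r0 by (simp add: field_simps power2_eq_square)
    finally show ?thesis by (simp add: n_def mult.commute)
  qed
  show ?thesis
    using one[of h] one[of "- h"] by (simp add: local_norm_minus[OF H_pos[OF x(1)]] abs_le_iff)
qed

lemma upper_bound:
  assumes x: "x \<in> Q" "x + v \<in> Q" and r: "local_norm (H x) v < 1"
  defines "r \<equiv> local_norm (H x) v"
  shows "f (x + v) \<le> f x + g x \<bullet> v + omega_star r"
proof -
  have r0: "r \<ge> 0" "r < 1" using local_norm_nonneg[OF H_pos[OF x(1)]] r by (auto simp: r_def)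
  have p: "1 - \<theta> * r > 0" if "0 \<le> \<theta>" "\<theta> \<le> 1" for \<theta>
    using mult_left_le_one_le[of r \<theta>] that r0 by simp
  have slope: "g (x + T *\<^sub>R v) \<bullet> v - g x \<bullet> v \<le> T * r\<^sup>2 / (1 - T * r)" if T: "0 \<le> T" "T \<le> 1" for T
  proof -
    let ?F = "\<lambda>\<theta>. r / (1 - \<theta> * r) - g (x + \<theta> *\<^sub>R v) \<bullet> v"
    have "?F 0 \<le> ?F T"
    proof (rule DERIV_nonneg_imp_nondecreasing[where f = ?F, OF T(1)])
      fix \<theta> :: real assume \<theta>: "0 \<le> \<theta>" "\<theta> \<le> T"
      then have \<theta>1: "\<theta> \<le> 1" using T by simp
      note in_Q = segment_in_Q[OF x \<theta>(1) \<theta>1]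
      have "local_norm (H (x + \<theta> *\<^sub>R v)) v * (1 - \<theta> * r) \<le> r"
        unfolding r_def by (rule norm_along_line(2)) (use \<theta> \<theta>1 x in \<open>auto intro: segment_in_Q\<close>)
      then have "local_norm (H (x + \<theta> *\<^sub>R v)) v \<le> r / (1 - \<theta> * r)"
        using p[OF \<theta>(1) \<theta>1] by (simp add: pos_le_divide_eq)
      then have "H (x + \<theta> *\<^sub>R v) v \<bullet> v \<le> (r / (1 - \<theta> * r))\<^sup>2"
        using power_mono[OF _ local_norm_nonneg[OF H_pos[OF in_Q]], of v _ 2] local_norm_square[OF H_pos[OF in_Q], of v]
        by fastforce
      moreover have "(?F has_real_derivative (r / (1 - \<theta> * r))\<^sup>2 - H (x + \<theta> *\<^sub>R v) v \<bullet> v) (at \<theta>)"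
        using p[OF \<theta>(1) \<theta>1]
        by (auto intro!: derivative_eq_intros gradient_deriv_along_line in_Q simp: power2_eq_square)
      ultimately show "\<exists>y. (?F has_real_derivative y) (at \<theta>) \<and> y \<ge> 0" by (intro exI conjI) auto
    qed
    then have "g (x + T *\<^sub>R v) \<bullet> v - g x \<bullet> v \<le> r / (1 - T * r) - r" by simp
    also have "\<dots> = T * r\<^sup>2 / (1 - T * r)" using p[OF T] by (simp add: field_simps power2_eq_square)
    finally show ?thesis .
  qed
  let ?F = "\<lambda>\<theta>. \<theta> * (g x \<bullet> v) + omega_star (\<theta> * r) - f (x + \<theta> *\<^sub>R v)"
  have "?F 0 \<le> ?F 1"
  proof (rule DERIV_nonneg_imp_nondecreasing[where f = ?F])
    fix \<theta> :: real assume \<theta>: "0 \<le> \<theta>" "\<theta> \<le> 1"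
    note in_Q = segment_in_Q[OF x \<theta>]
    have "((\<lambda>\<theta>. f (x + \<theta> *\<^sub>R v)) has_real_derivative g (x + \<theta> *\<^sub>R v) \<bullet> v) (at \<theta>)"
      by (rule has_real_derivative_along_line[OF f_deriv[OF in_Q]])
    moreover have "((\<lambda>\<theta>. \<theta> * (g x \<bullet> v)) has_real_derivative g x \<bullet> v) (at \<theta>)"
      by (auto intro!: derivative_eq_intros)
    ultimately have "(?F has_real_derivative g x \<bullet> v + \<theta> * r\<^sup>2 / (1 - \<theta> * r) - g (x + \<theta> *\<^sub>R v) \<bullet> v) (at \<theta>)"
      using p[OF \<theta>] by (intro DERIV_add DERIV_diff omega_star_scaled_deriv) auto
    then show "\<exists>y. (?F has_real_derivative y) (at \<theta>) \<and> y \<ge> 0"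
      using slope[OF \<theta>] by (intro exI conjI) auto
  qed simp
  then show ?thesis by simp
qed

text \<open>
  Along a ray the local norm of \<open>v\<close> decays no faster than \<open>r / (1 + \<theta> r)\<close>, so the slope grows in
  total by at least \<open>r\<close>. Since it stays nonpositive, it starts at \<open>- r\<close> or below. For barriers of
  cones this bounds the local norm of cone elements and yields the Dikin ellipsoids.
\<close>

lemma recession_bound:
  assumes ray: "\<And>\<theta>. \<theta> \<ge> 0 \<Longrightarrow> x + \<theta> *\<^sub>R v \<in> Q"
    and dec: "\<And>\<theta>. \<theta> \<ge> 0 \<Longrightarrow> g (x + \<theta> *\<^sub>R v) \<bullet> v \<le> 0"
  shows "local_norm (H x) v \<le> - (g x \<bullet> v)"
proof -
  define r where "r = local_norm (H x) v"
  have xQ: "x \<in> Q" using ray[of 0] by simp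
  have r0: "r \<ge> 0" using local_norm_nonneg[OF H_pos[OF xQ]] by (simp add: r_def)
  have p: "1 + \<theta> * r > 0" if "\<theta> \<ge> 0" for \<theta>
    using that r0 by (simp add: add_pos_nonneg)
  have le: "g x \<bullet> v + r \<le> 1 / T" if T: "T > 0" for T
  proof -
    let ?F = "\<lambda>\<theta>. g (x + \<theta> *\<^sub>R v) \<bullet> v + r / (1 + \<theta> * r)"
    have "?F 0 \<le> ?F T"
    proof (rule DERIV_nonneg_imp_nondecreasing[where f = ?F])
      fix \<theta> :: real assume \<theta>: "0 \<le> \<theta>" "\<theta> \<le> T"
      have "r \<le> local_norm (H (x + \<theta> *\<^sub>R v)) v * (1 + \<theta> * r)"
        unfolding r_def by (rule norm_along_line(1)) (use \<theta> ray in auto)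
      then have "r / (1 + \<theta> * r) \<le> local_norm (H (x + \<theta> *\<^sub>R v)) v"
        using p[OF \<theta>(1)] by (simp add: pos_divide_le_eq)
      then have "(r / (1 + \<theta> * r))\<^sup>2 \<le> H (x + \<theta> *\<^sub>R v) v \<bullet> v"
        using power_mono[of "r / (1 + \<theta> * r)" _ 2] r0 p[OF \<theta>(1)]
          local_norm_square[OF H_pos[OF ray[OF \<theta>(1)]], of v] by fastforce
      moreover have "(?F has_real_derivative H (x + \<theta> *\<^sub>R v) v \<bullet> v - (r / (1 + \<theta> * r))\<^sup>2) (at \<theta>)"
        using p[OF \<theta>(1)]
        by (auto intro!: derivative_eq_intros gradient_deriv_along_line ray \<theta> simp: power2_eq_square)
      ultimately show "\<exists>y. (?F has_real_derivative y) (at \<theta>) \<and> y \<ge> 0" by (intro exI conjI) auto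
    qed (use T in simp)
    then have "g x \<bullet> v + r \<le> r / (1 + T * r)" using dec[of T] T by simp
    also have "\<dots> \<le> 1 / T" using p[of T] T by (simp add: divide_simps)
    finally show ?thesis .
  qed
  (* Let T tend to infinity. *)
  have "g x \<bullet> v + r \<le> 0 + e" if "e > 0" for e
    using that le[of "1 / e"] by simp
  then have "g x \<bullet> v + r \<le> 0" by (rule field_le_epsilon)
  then show ?thesis by (simp add: r_def)
qed

end

section \<open>Derivatives of self-concordant functions\<close>

lemma grad_eqI:
  assumes "(f has_derivative (\<lambda>h. a \<bullet> h)) (at x)" shows "grad f x = a"
  unfolding grad_def
proof (rule the_equality)
  show "GDERIV f x :> a" using assms by (simp add: gderiv_def inner_commute)
  fix b assume "GDERIV f x :> b"
  then have "(\<lambda>h. h \<bullet> b) = (\<lambda>h. a \<bullet> h)" using assms has_derivative_unique by (auto simp: gderiv_def)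
  then show "b = a" by (metis inner_commute vector_eq_rdot)
qed

lemma differentiable_grad:
  assumes "f differentiable at x"
  shows "(f has_derivative (\<lambda>h. grad f x \<bullet> h)) (at x)"
proof -
  obtain f' where f': "(f has_derivative f') (at x)" using assms by (auto simp: differentiable_def)
  define a where "a = (\<Sum>i\<in>Basis. f' i *\<^sub>R i)"
  have "f' h = a \<bullet> h" for h
  proof -
    have "f' h = f' (\<Sum>i\<in>Basis. (h \<bullet> i) *\<^sub>R i)" by (simp add: euclidean_representation)
    also have "\<dots> = (\<Sum>i\<in>Basis. (h \<bullet> i) * f' i)"
      using has_derivative_linear[OF f'] by (simp add: linear_sum linear_cmul)
    also have "\<dots> = a \<bullet> h"
      by (simp add: a_def inner_sum_left inner_commute[of h] mult.commute)
    finally show ?thesis .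
  qed
  then have "(f has_derivative (\<lambda>h. a \<bullet> h)) (at x)" using f' by (metis ext)
  then show ?thesis using grad_eqI by blast
qed

lemma hess_eqI: "(grad f has_derivative f') (at x) \<Longrightarrow> hess f x = f'"
  unfolding hess_def using frechet_derivative_at by metis

context
  fixes Q :: "'a::euclidean_space set" and f :: "'a \<Rightarrow> real"
  assumes sc: "self_concordant_on Q f"
begin

lemma sc_open: "open Q" and sc_convex_on: "convex_on Q f" and sc_convex: "convex Q"
  using sc convex_on_imp_convex by (auto simp: self_concordant_on_def)

lemma sc_grad_deriv: "x \<in> Q \<Longrightarrow> (f has_derivative (\<lambda>h. grad f x \<bullet> h)) (at x)"
  using sc by (auto simp: self_concordant_on_def three_times_differentiable_on_def intro: differentiable_grad)

lemma sc_hess_deriv: "x \<in> Q \<Longrightarrow> (grad f has_derivative hess f x) (at x)"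
  using sc unfolding hess_def
  by (auto simp: self_concordant_on_def three_times_differentiable_on_def simp flip: frechet_derivative_works)

lemma sc_third_deriv:
  "x \<in> Q \<Longrightarrow> ((\<lambda>y. hess f y u) has_derivative frechet_derivative (\<lambda>y. hess f y u) (at x)) (at x)"
  using sc by (auto simp: self_concordant_on_def three_times_differentiable_on_def simp flip: frechet_derivative_works)

lemma sc_third_deriv_inner:
  assumes "x \<in> Q"
  shows "((\<lambda>y. hess f y u \<bullet> v) has_derivative third_deriv f x u v) (at x)"
proof -
  have "(\<lambda>y. hess f y u \<bullet> v) differentiable (at x)"
    using has_derivative_inner_left[OF sc_third_deriv[OF assms]] differentiableI by blast
  then show ?thesis unfolding third_deriv_def by (rule frechet_derivative_works[THEN iffD1])
qed

lemma third_deriv_inner: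
  "x \<in> Q \<Longrightarrow> third_deriv f x u v w = frechet_derivative (\<lambda>y. hess f y u) (at x) w \<bullet> v"
  using has_derivative_unique[OF sc_third_deriv_inner has_derivative_inner_left[OF sc_third_deriv]] by metis

lemma sc_hess_linear: "x \<in> Q \<Longrightarrow> linear (hess f x)"
  using sc_hess_deriv has_derivative_linear by blast

lemma sc_hess_sym: "x \<in> Q \<Longrightarrow> hess f x u \<bullet> v = u \<bullet> hess f x v"
  using second_derivative_symmetric[OF sc_open _ sc_grad_deriv sc_hess_deriv, of x u v]
  by (simp add: inner_commute)

lemma sc_third_deriv_sym12:
  assumes x: "x \<in> Q" shows "third_deriv f x u v w = third_deriv f x v u w"
proof -
  have "((\<lambda>y. hess f y u \<bullet> v) has_derivative third_deriv f x v u) (at x)"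
  proof (rule has_derivative_transform_within_open[OF sc_third_deriv_inner[OF x, of v u] sc_open x])
    show "hess f y v \<bullet> u = hess f y u \<bullet> v" if "y \<in> Q" for y
      unfolding sc_hess_sym[OF that, of v u] by (rule inner_commute)
  qed
  from has_derivative_unique[OF this sc_third_deriv_inner[OF x]] show ?thesis by simp
qed

text \<open>
  The map \<open>y \<mapsto> \<nabla>\<^sup>2f(y) v\<close> is the gradient of \<open>y \<mapsto> \<langle>\<nabla>f(y), v\<rangle>\<close>, so its derivative is a second
  derivative and symmetric.
\<close>

lemma sc_third_deriv_sym13:
  assumes x: "x \<in> Q" shows "third_deriv f x u v w = third_deriv f x w v u"
proof -
  have 1: "((\<lambda>y. grad f y \<bullet> v) has_derivative (\<lambda>h. hess f y v \<bullet> h)) (at y)" if "y \<in> Q" for y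
  proof -
    have "(\<lambda>h. hess f y h \<bullet> v) = (\<lambda>h. hess f y v \<bullet> h)"
      unfolding sc_hess_sym[OF that, of _ v] by (subst inner_commute) (rule refl)
    then show ?thesis using has_derivative_inner_left[OF sc_hess_deriv[OF that], of v] by simp
  qed
  have "frechet_derivative (\<lambda>y. hess f y v) (at x) w \<bullet> u = frechet_derivative (\<lambda>y. hess f y v) (at x) u \<bullet> w"
    by (rule second_derivative_symmetric[OF sc_open x 1 sc_third_deriv[OF x]])
  then show ?thesis
    by (simp add: sc_third_deriv_sym12[OF x, of _ v] third_deriv_inner[OF x, of v])
qed

lemma sc_third_deriv_sym23:
  assumes x: "x \<in> Q" shows "third_deriv f x u v w = third_deriv f x u w v"
  by (metis sc_third_deriv_sym12[OF x] sc_third_deriv_sym13[OF x])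

lemma sc_third_deriv_linear:
  assumes x: "x \<in> Q" shows "linear (\<lambda>u. third_deriv f x u v w)"
  using has_derivative_linear[OF sc_third_deriv_inner[OF x, of w v]]
  by (simp add: sc_third_deriv_sym13[OF x, of _ v w])

lemma sc_line_open: "open {\<theta>. x + \<theta> *\<^sub>R h \<in> Q}"
  by (intro open_vimage[OF sc_open, unfolded vimage_def] continuous_intros)

lemma sc_gradient_inequality:
  assumes x: "x \<in> Q" and y: "y \<in> Q"
  shows "f y \<ge> f x + grad f x \<bullet> (y - x)"
proof -
  define v where "v = y - x"
  define A where "A = {\<theta>. x + \<theta> *\<^sub>R v \<in> Q}"
  have oA: "open A" unfolding A_def by (rule sc_line_open)
  have comb: "x + ((1 - t) * a + t * b) *\<^sub>R v = (1 - t) *\<^sub>R (x + a *\<^sub>R v) + t *\<^sub>R (x + b *\<^sub>R v)" for t a b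
    by (simp add: algebra_simps)
  have cA: "convex A"
    unfolding convex_alt A_def using sc_convex by (auto simp: comb convex_alt)
  have "convex_on A (\<lambda>\<theta>. f (x + \<theta> *\<^sub>R v))"
  proof (rule convex_onI[OF _ cA])
    fix t a b :: real assume "0 < t" "t < 1" "a \<in> A" "b \<in> A"
    then show "f (x + ((1 - t) *\<^sub>R a + t *\<^sub>R b) *\<^sub>R v) \<le> (1 - t) * f (x + a *\<^sub>R v) + t * f (x + b *\<^sub>R v)"
      using convex_onD[OF sc_convex_on, of t "x + a *\<^sub>R v" "x + b *\<^sub>R v"] by (simp add: comb A_def)
  qed
  moreover have "((\<lambda>\<theta>. f (x + \<theta> *\<^sub>R v)) has_real_derivative grad f x \<bullet> v) (at 0 within A)"
    using has_real_derivative_along_line[of f _ x 0 v] sc_grad_deriv[OF x]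
    by (auto intro: has_field_derivative_at_within)
  moreover have "0 \<in> interior A" "1 \<in> A" using oA x y by (auto simp: A_def v_def interior_open)
  ultimately have "f (x + 1 *\<^sub>R v) - f (x + 0 *\<^sub>R v) \<ge> grad f x \<bullet> v * (1 - 0)"
    using convex_connected[OF cA] by (intro convex_on_imp_above_tangent)
  then show ?thesis by (simp add: v_def)
qed

lemma sc_hess_nonneg:
  assumes x: "x \<in> Q" shows "hess f x h \<bullet> h \<ge> 0"
proof (rule ccontr)
  assume neg: "\<not> hess f x h \<bullet> h \<ge> 0"
  have "((\<lambda>\<theta>. grad f (x + \<theta> *\<^sub>R h) \<bullet> h) has_real_derivative hess f x h \<bullet> h) (at 0)"
    using has_real_derivative_along_line[OF has_derivative_inner_left[OF sc_hess_deriv], of x 0 h h] x by simp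
  from DERIV_neg_dec_right[OF this] neg obtain d where d: "d > 0"
    "\<And>t. t > 0 \<Longrightarrow> t < d \<Longrightarrow> grad f (x + t *\<^sub>R h) \<bullet> h < grad f x \<bullet> h" by auto
  have "0 \<in> {\<theta>. x + \<theta> *\<^sub>R h \<in> Q}" using x by simp
  from openE[OF sc_line_open this] obtain e where e: "e > 0" "ball 0 e \<subseteq> {\<theta>. x + \<theta> *\<^sub>R h \<in> Q}" by blast
  define t where "t = min d e / 2"
  have t: "t > 0" "t < d" "t < e" using d e by (auto simp: t_def)
  have "t \<in> ball 0 e" using t by (simp add: dist_real_def)
  then have y: "x + t *\<^sub>R h \<in> Q" using e by blast
  from sc_gradient_inequality[OF x y] sc_gradient_inequality[OF y x]
  have "t * (grad f (x + t *\<^sub>R h) \<bullet> h) \<ge> t * (grad f x \<bullet> h)" by (simp add: algebra_simps)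
  then show False using d(2)[OF t(1,2)] t(1) by simp
qed

text \<open>
  Self-concordance bounds the third derivative from above only; replacing \<open>h\<close> by \<open>- h\<close> gives the
  lower bound.
\<close>

lemma sc_third_deriv_diag:
  assumes x: "x \<in> Q"
  shows "\<bar>third_deriv f x h h h\<bar> \<le> 2 * (hess f x h \<bullet> h) powr (3 / 2)"
proof -
  have le: "third_deriv f x h h h \<le> 2 * (hess f x h \<bullet> h) powr (3 / 2)" for h
    using sc x by (auto simp: self_concordant_on_def)
  have lin1: "third_deriv f x (- u) v w = - third_deriv f x u v w" for u v w
    using linear_neg[OF sc_third_deriv_linear[OF x]] .
  have "third_deriv f x (- h) (- h) (- h) = - third_deriv f x h h h"
    by (metis add.inverse_inverse lin1 sc_third_deriv_sym12[OF x] sc_third_deriv_sym13[OF x])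
  then show ?thesis using le[of h] le[of "- h"] linear_neg[OF sc_hess_linear[OF x], of h] by simp
qed

text \<open>
  If the Hessian form vanishes at one point in direction \<open>h\<close>, a Gronwall argument with
  \<open>\<bar>\<phi>'\<bar> \<le> 2 \<phi> powr (3/2)\<close> makes it vanish along the ray, so \<open>f\<close> is affine there. An affine function
  cannot leave a closed epigraph at a finite parameter, so the ray never leaves \<open>Q\<close>.
\<close>

lemma sc_degenerate_direction:
  assumes x: "x \<in> Q" and deg: "hess f x h \<bullet> h = 0" and T: "T \<ge> 0"
  shows "x + T *\<^sub>R h \<in> Q"
proof -
  define A where "A = {\<theta>. x + \<theta> *\<^sub>R h \<in> Q}"
  have seg: "x + \<theta> *\<^sub>R h \<in> Q" if "x + T *\<^sub>R h \<in> Q" "0 \<le> \<theta>" "\<theta> \<le> T" for \<theta> T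
  proof (cases "T = 0")
    case False
    have "(1 - \<theta> / T) *\<^sub>R x + (\<theta> / T) *\<^sub>R (x + T *\<^sub>R h) \<in> Q"
      using sc_convex x that False by (intro convexD) auto
    then show ?thesis using False by (simp add: algebra_simps)
  qed (use that x in auto)
  define \<phi> where "\<phi> = (\<lambda>\<theta>. hess f (x + \<theta> *\<^sub>R h) h \<bullet> h)"
  have \<phi>': "(\<phi> has_real_derivative third_deriv f (x + \<theta> *\<^sub>R h) h h h) (at \<theta>)" if "x + \<theta> *\<^sub>R h \<in> Q" for \<theta>
    unfolding \<phi>_def by (rule has_real_derivative_along_line[OF sc_third_deriv_inner[OF that]])
  have \<phi>0: "\<phi> T = 0" if TQ: "x + T *\<^sub>R h \<in> Q" and T: "T \<ge> 0" for T
  proof -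
    have "continuous_on {0..T} \<phi>"
      using DERIV_isCont[OF \<phi>'[OF seg[OF TQ]]] by (intro continuous_at_imp_continuous_on) auto
    then have "bounded (\<phi> ` {0..T})"
      using compact_continuous_image compact_imp_bounded compact_Icc by blast
    then obtain C where C: "\<And>\<theta>. 0 \<le> \<theta> \<Longrightarrow> \<theta> \<le> T \<Longrightarrow> \<phi> \<theta> \<le> C"
      unfolding bounded_iff by (metis abs_le_D1 atLeastAtMost_iff image_eqI real_norm_def)
    (* On the compact segment, \<phi> powr (3/2) is at most sqrt C * \<phi>, so that this product decreases. *)
    let ?k = "\<lambda>\<theta>. \<phi> \<theta> * exp (- (2 * sqrt C) * \<theta>)"
    have "?k T \<le> ?k 0"
    proof (rule DERIV_nonpos_imp_nonincreasing[where f = ?k, OF T])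
      fix \<theta> assume \<theta>: "0 \<le> \<theta>" "\<theta> \<le> T"
      note in_Q = seg[OF TQ \<theta>]
      define d where "d = third_deriv f (x + \<theta> *\<^sub>R h) h h h"
      have p: "\<phi> \<theta> \<ge> 0" unfolding \<phi>_def by (rule sc_hess_nonneg[OF in_Q])
      have "d \<le> 2 * (\<phi> \<theta>) powr (3 / 2)"
        using sc_third_deriv_diag[OF in_Q, of h] by (simp add: d_def \<phi>_def)
      also have "(\<phi> \<theta>) powr (3 / 2) = (\<phi> \<theta>) powr (1 + 1 / 2)" by simp
      also have "\<dots> = \<phi> \<theta> * sqrt (\<phi> \<theta>)" using p by (simp only: powr_add powr_half_sqrt powr_one)
      also have "\<dots> \<le> \<phi> \<theta> * sqrt C" using p C[OF \<theta>] by (intro mult_left_mono) auto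
      finally have "d \<le> 2 * sqrt C * \<phi> \<theta>" by (simp add: mult_ac)
      then have "(d - 2 * sqrt C * \<phi> \<theta>) * exp (- (2 * sqrt C) * \<theta>) \<le> 0"
        by (intro mult_nonpos_nonneg) auto
      moreover have "(?k has_real_derivative (d - 2 * sqrt C * \<phi> \<theta>) * exp (- (2 * sqrt C) * \<theta>)) (at \<theta>)"
        by (auto intro!: derivative_eq_intros \<phi>'[OF in_Q] simp: d_def algebra_simps)
      ultimately show "\<exists>y. (?k has_real_derivative y) (at \<theta>) \<and> y \<le> 0" by blast
    qed
    then have "\<phi> T * exp (- (2 * sqrt C) * T) \<le> 0" using deg by (simp add: \<phi>_def)
    then have "\<phi> T \<le> 0" by (simp add: mult_le_0_iff)
    then show ?thesis using sc_hess_nonneg[OF TQ, of h] by (simp add: \<phi>_def)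
  qed
  have g0: "grad f (x + T *\<^sub>R h) \<bullet> h = grad f x \<bullet> h" if TQ: "x + T *\<^sub>R h \<in> Q" and T: "T \<ge> 0" for T
  proof (cases "T = 0")
    case False
    have "\<exists>z. 0 < z \<and> z < T \<and> grad f (x + T *\<^sub>R h) \<bullet> h - grad f (x + 0 *\<^sub>R h) \<bullet> h = (T - 0) * \<phi> z"
      unfolding \<phi>_def using T False seg[OF TQ]
      by (intro MVT2 has_real_derivative_along_line[OF has_derivative_inner_left[OF sc_hess_deriv]]) auto
    then show ?thesis using \<phi>0 seg[OF TQ] by auto
  qed simp
  have aff: "f (x + T *\<^sub>R h) = f x + T * (grad f x \<bullet> h)" if TQ: "x + T *\<^sub>R h \<in> Q" and T: "T \<ge> 0" for T
  proof (cases "T = 0")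
    case False
    have "\<exists>z. 0 < z \<and> z < T \<and> f (x + T *\<^sub>R h) - f (x + 0 *\<^sub>R h) = (T - 0) * (grad f (x + z *\<^sub>R h) \<bullet> h)"
      using T False seg[OF TQ]
      by (intro MVT2 has_real_derivative_along_line[OF sc_grad_deriv]) auto
    then obtain z where "0 < z" "z < T" "f (x + T *\<^sub>R h) = f x + T * (grad f (x + z *\<^sub>R h) \<bullet> h)" by auto
    then show ?thesis using g0[OF seg[OF TQ]] by simp
  qed simp
  (* The admissible parameters form an open set, and by affinity also the preimage of the closed
     epigraph under an affine map, hence a clopen part of the half-line. *)
  have eq: "{0..} \<inter> A = {0..} \<inter> (\<lambda>\<theta>. (x + \<theta> *\<^sub>R h, f x + \<theta> * (grad f x \<bullet> h))) -` epigraph Q f"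
    using aff by (auto simp: A_def epigraph_def)
  have "closed ((\<lambda>\<theta>. (x + \<theta> *\<^sub>R h, f x + \<theta> * (grad f x \<bullet> h))) -` epigraph Q f)"
    using sc by (intro closed_vimage continuous_intros) (auto simp: self_concordant_on_def)
  then have "closedin (top_of_set {0..}) ({0..} \<inter> A)" unfolding eq by (intro closedin_closed_Int)
  moreover have "openin (top_of_set {0..}) ({0..} \<inter> A)"
    using sc_line_open by (intro openin_open_Int) (simp add: A_def)
  moreover have "0 \<in> {0..} \<inter> A" using x by (simp add: A_def)
  moreover have "connected {0::real..}" by (intro convex_connected) auto
  ultimately have "{0..} \<inter> A = {0..}" unfolding connected_clopen by blast
  then show ?thesis using T by (auto simp: A_def)
qed

end

section \<open>Normal barriers are self-concordant fields\<close>

text \<open>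
  Scaling the ray by \<open>1 / n\<close> keeps it in the cone, and \<open>x / n + h\<close> tends to \<open>h\<close>.
\<close>

lemma cone_recession:
  fixes K :: "'a::euclidean_space set"
  assumes "closed K" "cone K" and line: "\<And>T. T \<ge> 0 \<Longrightarrow> x + T *\<^sub>R h \<in> K"
  shows "h \<in> K"
proof -
  have mem: "inverse (real (Suc n)) *\<^sub>R x + h \<in> K" for n
  proof -
    have "inverse (real (Suc n)) *\<^sub>R (x + real (Suc n) *\<^sub>R h) \<in> K"
      using line \<open>cone K\<close> unfolding cone_def by (metis inverse_nonnegative_iff_nonnegative of_nat_0_le_iff)
    then show ?thesis by (simp add: scaleR_add_right del: of_nat_Suc)
  qed
  have lim: "(\<lambda>n. inverse (real (Suc n)) *\<^sub>R x + h) \<longlonglongrightarrow> 0 *\<^sub>R x + h"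
    by (intro tendsto_intros LIMSEQ_inverse_real_of_nat)
  have "0 *\<^sub>R x + h \<in> K"
    by (rule closed_sequentially[OF \<open>closed K\<close> _ lim]) (rule mem)
  then show ?thesis by simp
qed

text \<open>
  A degenerate direction of the Hessian would, together with its negative, lie in \<open>K\<close>, against
  pointedness. With the Hessian positive definite, the bound on the diagonal of the third derivative
  extends to its mixed values.
\<close>

lemma normal_barrier_self_concordant_field:
  assumes K: "closed K" "cone K" "\<forall>x. x \<in> K \<and> - x \<in> K \<longrightarrow> x = 0"
    and F: "normal_barrier \<nu> K F"
  shows "self_concordant_field (interior K) F (grad F) (hess F)"
proof -
  have sc: "self_concordant_on (interior K) F" using F by (simp add: normal_barrier_def)
  have pos: "pos_def_op (hess F x)" if x: "x \<in> interior K" for x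
    unfolding pos_def_op_def
  proof (intro conjI allI impI)
    show "linear (hess F x)" by (rule sc_hess_linear[OF sc x])
    show "hess F x u \<bullet> v = u \<bullet> hess F x v" for u v by (rule sc_hess_sym[OF sc x])
    fix h :: 'a assume "h \<noteq> 0"
    show "hess F x h \<bullet> h > 0"
    proof (rule ccontr)
      assume "\<not> hess F x h \<bullet> h > 0"
      then have 0: "hess F x h \<bullet> h = 0" using sc_hess_nonneg[OF sc x, of h] by simp
      then have 1: "hess F x (- h) \<bullet> (- h) = 0" using linear_neg[OF sc_hess_linear[OF sc x]] by simp
      have "h \<in> K"
        by (rule cone_recession[OF K(1,2), of x])
          (rule subsetD[OF interior_subset sc_degenerate_direction[OF sc x 0]])
      moreover have "- h \<in> K"
        by (rule cone_recession[OF K(1,2), of x])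
          (rule subsetD[OF interior_subset sc_degenerate_direction[OF sc x 1]])
      ultimately
      show False using K(3) \<open>h \<noteq> 0\<close> by blast
    qed
  qed
  have third: "\<bar>third_deriv F x h h w\<bar> \<le> 2 * local_norm (hess F x) w * (hess F x h \<bullet> h)"
    if x: "x \<in> interior K" for x h w
  proof -
    have "\<bar>third_deriv F x h h h\<bar> \<le> 2 * local_norm (hess F x) h ^ 3" for h
    proof -
      have "(hess F x h \<bullet> h) powr (3 / 2) = (local_norm (hess F x) h)\<^sup>2 powr (3 / 2)"
        by (simp add: local_norm_square[OF pos[OF x]])
      also have "\<dots> = local_norm (hess F x) h ^ 3"
      proof (cases "local_norm (hess F x) h = 0")
        case False
        then have n: "local_norm (hess F x) h > 0" using local_norm_nonneg[OF pos[OF x], of h] by simp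
        then have "(local_norm (hess F x) h)\<^sup>2 powr (3 / 2) = local_norm (hess F x) h powr 3"
          by (simp add: powr_powr flip: powr_numeral)
        then show ?thesis using n by (simp add: powr_numeral)
      qed simp
      finally show ?thesis using sc_third_deriv_diag[OF sc x, of h] by simp
    qed
    from symmetric_trilinear_diagonal_bound[OF pos[OF x] sc_third_deriv_linear[OF sc x]
        sc_third_deriv_sym12[OF sc x] sc_third_deriv_sym23[OF sc x] this, of w h]
    have "\<bar>third_deriv F x w h h\<bar> \<le> 2 * local_norm (hess F x) w * (local_norm (hess F x) h)\<^sup>2" .
    then show ?thesis
      by (simp add: local_norm_square[OF pos[OF x]] sc_third_deriv_sym13[OF sc x, of h h w])
  qed
  show ?thesis
  proof
    show "open (interior K)" "convex (interior K)" using sc_open[OF sc] sc_convex[OF sc] by auto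
    fix x assume x: "x \<in> interior K"
    show "(F has_derivative (\<lambda>h. grad F x \<bullet> h)) (at x)" by (rule sc_grad_deriv[OF sc x])
    show "(grad F has_derivative hess F x) (at x)" by (rule sc_hess_deriv[OF sc x])
    show "pos_def_op (hess F x)" by (rule pos[OF x])
    show "\<exists>D. ((\<lambda>y. hess F y h \<bullet> h) has_derivative D) (at x) \<and>
        (\<forall>w. \<bar>D w\<bar> \<le> 2 * local_norm (hess F x) w * (hess F x h \<bullet> h))" for h
      using sc_third_deriv_inner[OF sc x, of h h] third[OF x, of h] by blast
  qed
qed

section \<open>Cones and their duals\<close>

lemma convex_cone_add:
  assumes "convex K" "cone K" "x \<in> K" "y \<in> K"
  shows "x + y \<in> K"
  using assms convex_cone[of K] by blast

lemma interior_convex_cone_add: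
  fixes K :: "'a::euclidean_space set"
  assumes "convex K" "cone K" "x \<in> interior K" "y \<in> K"
  shows "x + y \<in> interior K"
proof -
  have "(+) y ` interior K \<subseteq> interior K"
  proof (rule interior_maximal)
    show "(+) y ` interior K \<subseteq> K"
      using assms convex_cone_add[OF assms(1,2)] interior_subset[of K] by blast
    show "open ((+) y ` interior K)" by (intro open_translation open_interior)
  qed
  then show ?thesis using assms(3) by (auto simp: add.commute)
qed

lemma interior_cone_scale:
  fixes K :: "'a::euclidean_space set"
  assumes "cone K" "x \<in> interior K" "c > 0"
  shows "c *\<^sub>R x \<in> interior K"
proof -
  have "(*\<^sub>R) c ` interior K \<subseteq> interior K"
  proof (rule interior_maximal)
    show "(*\<^sub>R) c ` interior K \<subseteq> K"
      using assms interior_subset[of K] unfolding cone_def by fastforce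
    show "open ((*\<^sub>R) c ` interior K)" using assms by (intro open_scaling) auto
  qed
  then show ?thesis using assms(2) by auto
qed

lemma convex_dual_cone: "convex (dual_cone K)"
  by (rule convexI) (auto simp: dual_cone_def inner_add_left)

lemma cone_dual_cone: "cone (dual_cone K)"
  by (auto simp: dual_cone_def cone_def)

text \<open>
  Moving \<open>s\<close> by \<open>\<epsilon>\<close> against the direction of \<open>x\<close> changes \<open>\<langle>s, x\<rangle>\<close> by \<open>\<epsilon> \<parallel>x\<parallel>\<close>, which is the largest change
  that a displacement of that length can cause.
\<close>

lemma mem_interior_dual_cone_iff:
  fixes K :: "'a::euclidean_space set"
  shows "s \<in> interior (dual_cone K) \<longleftrightarrow> (\<exists>\<epsilon>>0. \<forall>x\<in>K. \<epsilon> * norm x \<le> s \<bullet> x)"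
proof
  assume "s \<in> interior (dual_cone K)"
  then obtain e where e: "e > 0" "cball s e \<subseteq> dual_cone K" by (meson mem_interior_cball)
  have "e * norm x \<le> s \<bullet> x" if "x \<in> K" for x
  proof (cases "x = 0")
    case False
    have "s - (e / norm x) *\<^sub>R x \<in> cball s e" using False e by (simp add: dist_norm)
    from subsetD[OF e(2) this] have "(s - (e / norm x) *\<^sub>R x) \<bullet> x \<ge> 0"
      using that unfolding dual_cone_def by blast
    then show ?thesis using False by (simp add: inner_diff_left dot_square_norm power2_eq_square)
  qed simp
  then show "\<exists>\<epsilon>>0. \<forall>x\<in>K. \<epsilon> * norm x \<le> s \<bullet> x" using e by blast
next
  assume "\<exists>\<epsilon>>0. \<forall>x\<in>K. \<epsilon> * norm x \<le> s \<bullet> x"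
  then obtain e where e: "e > 0" "\<And>x. x \<in> K \<Longrightarrow> e * norm x \<le> s \<bullet> x" by blast
  have "ball s e \<subseteq> dual_cone K"
  proof
    fix d assume d: "d \<in> ball s e"
    have "0 \<le> d \<bullet> x" if "x \<in> K" for x
    proof -
      have "\<bar>(s - d) \<bullet> x\<bar> \<le> norm (s - d) * norm x" by (rule Cauchy_Schwarz_ineq2)
      also have "\<dots> \<le> e * norm x" using d by (intro mult_right_mono) (auto simp: dist_norm)
      finally show ?thesis using e(2)[OF that] by (simp add: inner_diff_left)
    qed
    then show "d \<in> dual_cone K" by (simp add: dual_cone_def)
  qed
  then show "s \<in> interior (dual_cone K)" using e mem_interior by blast
qed

text \<open>
  A point outside \<open>K\<close> is strictly separated from it, and the separating functional is nonnegative
  on \<open>K\<close> because \<open>K\<close> is a cone.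
\<close>

lemma dual_cone_dual_cone:
  fixes K :: "'a::euclidean_space set"
  assumes K: "closed K" "convex K" "cone K" "K \<noteq> {}"
  shows "dual_cone (dual_cone K) = K"
proof
  show "K \<subseteq> dual_cone (dual_cone K)" by (auto simp: dual_cone_def inner_commute)
  show "dual_cone (dual_cone K) \<subseteq> K"
  proof (rule subsetI, rule ccontr)
    fix z assume z: "z \<in> dual_cone (dual_cone K)" "z \<notin> K"
    obtain a b where ab: "a \<bullet> z < b" "\<And>x. x \<in> K \<Longrightarrow> b < a \<bullet> x"
      using separating_hyperplane_closed_point[OF K(2,1) z(2)] by blast
    have "0 \<in> K" using K(3,4) cone_contains_0 by blast
    then have b: "b < 0" using ab(2)[of 0] by simp
    have "a \<bullet> x \<ge> 0" if x: "x \<in> K" for x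
    proof (rule ccontr)
      assume neg: "\<not> a \<bullet> x \<ge> 0"
      have "(b / (a \<bullet> x)) *\<^sub>R x \<in> K" using K(3) x b neg by (auto simp: cone_def divide_nonpos_neg)
      from ab(2)[OF this] neg show False by simp
    qed
    then have "a \<in> dual_cone K" by (simp add: dual_cone_def)
    then have "z \<bullet> a \<ge> 0" using z(1) by (auto simp: dual_cone_def)
    then show False using ab(1) b by (simp add: inner_commute)
  qed
qed

text \<open>
  The common source of the primal and the dual Dikin ellipsoid: if \<open>p\<close> dominates the norm of \<open>M\<close> on
  \<open>C\<close>, a perturbation of dual norm below 1 cannot make it lose positivity there.
\<close>

lemma dikin_interior_dual_cone:
  fixes C :: "'a::euclidean_space set"
  assumes M: "pos_def_op M" and p: "\<And>y. y \<in> C \<Longrightarrow> local_norm M y \<le> p \<bullet> y"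
    and d: "local_norm (inv M) d < 1"
  shows "p + d \<in> interior (dual_cone C)"
proof -
  obtain m where m: "m > 0" "\<And>h. m * norm h \<le> local_norm M h"
    using pos_def_op_lower_bound[OF M] by auto
  define r where "r = local_norm (inv M) d"
  have "(1 - r) * m * norm y \<le> (p + d) \<bullet> y" if "y \<in> C" for y
  proof -
    have "local_norm M (inv M d) = r"
      using pos_def_op_inv(4)[OF M, of "inv M d"] by (simp add: pos_def_op_inv(1)[OF M] r_def)
    then have "\<bar>d \<bullet> y\<bar> \<le> r * local_norm M y"
      using local_norm_Cauchy_Schwarz[OF M, of "inv M d" y] by (simp add: pos_def_op_inv(1)[OF M])
    then have "(1 - r) * local_norm M y \<le> (p + d) \<bullet> y"
      using p[OF that] by (simp add: inner_add_left left_diff_distrib)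
    moreover have "(1 - r) * (m * norm y) \<le> (1 - r) * local_norm M y"
      using m(2) d by (intro mult_left_mono) (auto simp: r_def)
    ultimately show ?thesis by (simp add: mult.assoc)
  qed
  moreover have "(1 - r) * m > 0" using m(1) d by (simp add: r_def)
  ultimately show ?thesis unfolding mem_interior_dual_cone_iff by blast
qed

section \<open>Normal barriers of cones\<close>

lemma has_derivative_scaled_argument:
  fixes G :: "'a::real_normed_vector \<Rightarrow> 'b::real_normed_vector"
  assumes "(G has_derivative G') (at (c *\<^sub>R x))"
  shows "((\<lambda>y. G (c *\<^sub>R y)) has_derivative (\<lambda>h. G' (c *\<^sub>R h))) (at x)"
proof (rule has_derivative_compose[of "\<lambda>y. c *\<^sub>R y" "\<lambda>h. c *\<^sub>R h" x UNIV G G', OF _ assms])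
  show "((\<lambda>y. c *\<^sub>R y) has_derivative (\<lambda>h. c *\<^sub>R h)) (at x)" by (auto intro!: derivative_eq_intros)
qed

locale cone_with_normal_barrier =
  fixes \<nu> :: real and K :: "'a::euclidean_space set" and F :: "'a \<Rightarrow> real"
  assumes closed_K: "closed K" and convex_K: "convex K" and cone_K: "cone K"
    and pointed_K: "\<forall>x. x \<in> K \<and> - x \<in> K \<longrightarrow> x = 0"
    and interior_K: "interior K \<noteq> {}"
    and barrier: "normal_barrier \<nu> K F"

sublocale cone_with_normal_barrier \<subseteq> primal: self_concordant_field "interior K" F "grad F" "hess F"
  by (rule normal_barrier_self_concordant_field[OF closed_K cone_K pointed_K barrier])

context cone_with_normal_barrier
begin

lemma sc: "self_concordant_on (interior K) F"
  using barrier by (simp add: normal_barrier_def)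

lemma \<nu>_ge_1: "\<nu> \<ge> 1"
  using barrier by (simp add: normal_barrier_def)

lemma log_homogeneous: "x \<in> interior K \<Longrightarrow> \<tau> > 0 \<Longrightarrow> F (\<tau> *\<^sub>R x) = F x - \<nu> * ln \<tau>"
  using barrier by (simp add: normal_barrier_def)

lemmas scale_interior = interior_cone_scale[OF cone_K]

lemma grad_scale:
  assumes x: "x \<in> interior K" and \<tau>: "\<tau> > 0"
  shows "grad F (\<tau> *\<^sub>R x) = (1 / \<tau>) *\<^sub>R grad F x"
proof -
  have "((\<lambda>y. F (\<tau> *\<^sub>R y) + \<nu> * ln \<tau>) has_derivative (\<lambda>h. grad F (\<tau> *\<^sub>R x) \<bullet> (\<tau> *\<^sub>R h))) (at x)"
    by (auto intro!: derivative_eq_intros has_derivative_scaled_argument[OF primal.f_deriv[OF scale_interior[OF x \<tau>]]])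
  then have "(F has_derivative (\<lambda>h. (\<tau> *\<^sub>R grad F (\<tau> *\<^sub>R x)) \<bullet> h)) (at x)"
    using has_derivative_transform_within_open[OF _ open_interior x, of _ _ UNIV F] \<tau>
    by (simp add: log_homogeneous)
  from grad_eqI[OF this] show ?thesis using \<tau> by simp
qed

lemma hess_scale:
  assumes x: "x \<in> interior K" and \<tau>: "\<tau> > 0"
  shows "hess F (\<tau> *\<^sub>R x) h = (1 / \<tau>\<^sup>2) *\<^sub>R hess F x h"
proof -
  have "((\<lambda>y. \<tau> *\<^sub>R grad F (\<tau> *\<^sub>R y)) has_derivative (\<lambda>h. \<tau> *\<^sub>R hess F (\<tau> *\<^sub>R x) (\<tau> *\<^sub>R h))) (at x)"
    by (intro has_derivative_scaleR_right has_derivative_scaled_argument primal.g_deriv scale_interior x \<tau>)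
  then have "(grad F has_derivative (\<lambda>h. \<tau> *\<^sub>R hess F (\<tau> *\<^sub>R x) (\<tau> *\<^sub>R h))) (at x)"
    using has_derivative_transform_within_open[OF _ open_interior x, of _ _ UNIV "grad F"] \<tau>
    by (simp add: grad_scale)
  from hess_eqI[OF this] have "hess F x h = \<tau> *\<^sub>R hess F (\<tau> *\<^sub>R x) (\<tau> *\<^sub>R h)" by simp
  also have "\<dots> = \<tau>\<^sup>2 *\<^sub>R hess F (\<tau> *\<^sub>R x) h"
    using linear_cmul[OF pos_def_op_linear[OF primal.H_pos[OF scale_interior[OF x \<tau>]]]]
    by (simp add: power2_eq_square)
  finally show ?thesis using \<tau> by simp
qed

lemma grad_inner_self:
  assumes x: "x \<in> interior K" shows "grad F x \<bullet> x = - \<nu>"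
proof -
  have "((\<lambda>\<theta>. F (x + \<theta> *\<^sub>R x)) has_real_derivative grad F x \<bullet> x) (at 0)"
    using has_real_derivative_along_line[of F _ x 0 x] primal.f_deriv[OF x] by simp
  moreover have "((\<lambda>\<theta>. F (x + \<theta> *\<^sub>R x)) has_real_derivative - \<nu>) (at 0)"
  proof (rule has_field_derivative_transform_within_open[where S = "{-1<..}" and f = "\<lambda>\<theta>. F x - \<nu> * ln (1 + \<theta>)"])
    show "F x - \<nu> * ln (1 + \<theta>) = F (x + \<theta> *\<^sub>R x)" if "\<theta> \<in> {-1<..}" for \<theta>
      using log_homogeneous[OF x, of "1 + \<theta>"] that by (simp add: scaleR_add_left)
  qed (auto intro!: derivative_eq_intros)
  ultimately show ?thesis by (rule DERIV_unique)
qed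

lemma hess_self:
  assumes x: "x \<in> interior K" shows "hess F x x = - grad F x"
proof -
  have "hess F x x \<bullet> u = - grad F x \<bullet> u" for u
  proof (rule DERIV_unique)
    show "((\<lambda>\<theta>. grad F (x + \<theta> *\<^sub>R x) \<bullet> u) has_real_derivative hess F x x \<bullet> u) (at 0)"
      using primal.gradient_deriv_along_line[of x 0 x u] x by simp
    show "((\<lambda>\<theta>. grad F (x + \<theta> *\<^sub>R x) \<bullet> u) has_real_derivative - grad F x \<bullet> u) (at 0)"
    proof (rule has_field_derivative_transform_within_open[where S = "{-1<..}" and f = "\<lambda>\<theta>. inverse (1 + \<theta>) * (grad F x \<bullet> u)"])
      show "inverse (1 + \<theta>) * (grad F x \<bullet> u) = grad F (x + \<theta> *\<^sub>R x) \<bullet> u" if "\<theta> \<in> {-1<..}" for \<theta>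
        using grad_scale[OF x, of "1 + \<theta>"] that by (simp add: scaleR_add_left inverse_eq_divide)
    qed (auto intro!: derivative_eq_intros)
  qed
  then show ?thesis by (metis vector_eq_rdot)
qed

text \<open>
  If \<open>F\<close> had positive slope at \<open>y\<close> towards an interior point \<open>h\<close>, convexity would make \<open>F(\<tau> h)\<close> grow
  linearly in \<open>\<tau>\<close>, whereas it decreases logarithmically. Points of the boundary are approached by
  adding small multiples of \<open>y\<close>.
\<close>

lemma grad_inner_nonpos:
  assumes y: "y \<in> interior K" and h: "h \<in> K"
  shows "grad F y \<bullet> h \<le> 0"
proof -
  have int: "grad F y \<bullet> h \<le> 0" if h: "h \<in> interior K" for h
  proof (rule ccontr)
    assume pos: "\<not> grad F y \<bullet> h \<le> 0"
    define a where "a = grad F y \<bullet> h"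
    define C where "C = F h - F y + grad F y \<bullet> y"
    have a: "a > 0" using pos by (simp add: a_def)
    have bd: "\<tau> * a \<le> C" if \<tau>: "\<tau> \<ge> 1" for \<tau>
    proof -
      have "F (\<tau> *\<^sub>R h) \<ge> F y + grad F y \<bullet> (\<tau> *\<^sub>R h - y)"
        using scale_interior[OF h] \<tau> by (intro sc_gradient_inequality[OF sc y]) auto
      moreover have "\<nu> * ln \<tau> \<ge> 0" using \<nu>_ge_1 \<tau> by simp
      ultimately show ?thesis using log_homogeneous[OF h, of \<tau>] \<tau>
        by (simp add: inner_diff_right a_def C_def)
    qed
    define \<tau> where "\<tau> = 1 + \<bar>C\<bar> / a"
    have "\<tau> \<ge> 1" using a by (simp add: \<tau>_def)
    from bd[OF this] have "a + \<bar>C\<bar> \<le> C" using a by (simp add: \<tau>_def distrib_right)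
    then show False using a by linarith
  qed
  have "grad F y \<bullet> h \<le> 0 + e" if "e > 0" for e
  proof -
    define \<delta> where "\<delta> = e / \<nu>"
    have \<delta>: "\<delta> > 0" using that \<nu>_ge_1 by (simp add: \<delta>_def)
    have "\<delta> *\<^sub>R y + h \<in> interior K"
      by (intro interior_convex_cone_add[OF convex_K cone_K] scale_interior y h \<delta>)
    from int[OF this] show ?thesis
      using grad_inner_self[OF y] \<nu>_ge_1 by (simp add: inner_add_right \<delta>_def)
  qed
  then show ?thesis by (rule field_le_epsilon)
qed

lemma hess_norm_le_neg_grad:
  assumes x: "x \<in> interior K" and h: "h \<in> K"
  shows "local_norm (hess F x) h \<le> - grad F x \<bullet> h"
proof -
  have "x + \<theta> *\<^sub>R h \<in> interior K" if "\<theta> \<ge> 0" for \<theta>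
    using that h cone_K by (intro interior_convex_cone_add[OF convex_K cone_K x]) (auto simp: cone_def)
  then show ?thesis using primal.recession_bound[of x h] grad_inner_nonpos h by simp
qed

lemma neg_grad_in_interior_dual:
  assumes x: "x \<in> interior K" shows "- grad F x \<in> interior (dual_cone K)"
  using dikin_interior_dual_cone[OF primal.H_pos[OF x] hess_norm_le_neg_grad[OF x], of K 0]
    local_norm_zero[OF pos_def_op_inv(3)[OF primal.H_pos[OF x]]] by simp

section \<open>The dual barrier\<close>

text \<open>
  The function \<open>\<langle>s, x\<rangle> + F x\<close> grows linearly at infinity, because \<open>s\<close> is positive on the cone while
  \<open>F\<close> decreases only logarithmically along rays, and its sublevel sets are closed because the
  epigraph is. A minimizer therefore exists, and its gradient vanishes.
\<close>

lemma dual_maximizer_exists: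
  assumes s: "s \<in> interior (dual_cone K)"
  shows "\<exists>x\<in>interior K. grad F x = - s"
proof -
  obtain \<epsilon> where \<epsilon>: "\<epsilon> > 0" "\<And>x. x \<in> K \<Longrightarrow> \<epsilon> * norm x \<le> s \<bullet> x"
    using s unfolding mem_interior_dual_cone_iff by blast
  obtain x0 where x0: "x0 \<in> interior K" using interior_K by blast
  define M where "M = s \<bullet> x0 + F x0"
  define L where "L = (\<lambda>x. (x, M - s \<bullet> x)) -` epigraph (interior K) F"
  have L: "x \<in> L \<longleftrightarrow> x \<in> interior K \<and> s \<bullet> x + F x \<le> M" for x
    by (auto simp: L_def epigraph_def)
  have "closed L" unfolding L_def using sc
    by (intro closed_vimage continuous_intros) (auto simp: self_concordant_on_def)
  moreover have "bounded L"
  proof -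
    define c where "c = F x0 - norm (grad F x0) * (1 + norm x0)"
    (* c bounds F below on points of norm 1. The bound B solves eps r + c - nu ln r <= M for r after
       nu ln r is replaced by its tangent estimate eps r / 2 + nu ln (2 nu / eps). *)
    define B where "B = (M - c + \<nu> * ln (2 * \<nu> / \<epsilon>)) * (2 / \<epsilon>)"
    have "norm x \<le> max 1 B" if x: "x \<in> L" for x
    proof (cases "norm x \<le> 1")
      case False
      define r where "r = norm x"
      have r: "r > 1" using False by (simp add: r_def)
      have xK: "x \<in> interior K" "s \<bullet> x + F x \<le> M" using x L by auto
      define u where "u = (1 / r) *\<^sub>R x"
      have u: "u \<in> interior K" unfolding u_def using r by (intro scale_interior xK) auto
      have "F u \<ge> F x0 + grad F x0 \<bullet> (u - x0)" by (rule sc_gradient_inequality[OF sc x0 u])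
      moreover have "\<bar>grad F x0 \<bullet> (u - x0)\<bar> \<le> norm (grad F x0) * (1 + norm x0)"
      proof -
        have "norm (u - x0) \<le> 1 + norm x0"
          using norm_triangle_ineq4[of u x0] r by (simp add: u_def r_def split: if_splits)
        then show ?thesis using Cauchy_Schwarz_ineq2[of "grad F x0" "u - x0"]
          by (meson mult_left_mono norm_ge_zero order_trans)
      qed
      ultimately have "F u \<ge> c" by (simp add: c_def abs_le_iff)
      moreover have "F u = F x + \<nu> * ln r"
        using log_homogeneous[OF xK(1), of "1 / r"] r by (simp add: u_def ln_div)
      moreover have "\<epsilon> * r \<le> s \<bullet> x" using \<epsilon>(2)[of x] xK(1) interior_subset by (auto simp: r_def)
      ultimately have 1: "\<epsilon> * r + c - \<nu> * ln r \<le> M" using xK(2) by linarith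
      have "ln r = ln (\<epsilon> * r / (2 * \<nu>)) + ln (2 * \<nu> / \<epsilon>)"
        using r \<epsilon>(1) \<nu>_ge_1 by (simp add: ln_mult ln_div)
      also have "ln (\<epsilon> * r / (2 * \<nu>)) \<le> \<epsilon> * r / (2 * \<nu>)"
        using ln_le_minus_one[of "\<epsilon> * r / (2 * \<nu>)"] r \<epsilon>(1) \<nu>_ge_1 by simp
      finally have "\<nu> * ln r \<le> \<nu> * (\<epsilon> * r / (2 * \<nu>) + ln (2 * \<nu> / \<epsilon>))"
        using \<nu>_ge_1 by (intro mult_left_mono) auto
      also have "\<dots> = \<epsilon> * r / 2 + \<nu> * ln (2 * \<nu> / \<epsilon>)"
        using \<nu>_ge_1 by (simp add: distrib_left)
      finally have "\<epsilon> * r / 2 \<le> M - c + \<nu> * ln (2 * \<nu> / \<epsilon>)" using 1 by simp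
      then have "r \<le> B" using \<epsilon>(1) by (simp add: B_def field_simps)
      then show ?thesis by (simp add: r_def)
    qed simp
    then show ?thesis unfolding bounded_iff by blast
  qed
  ultimately have comp: "compact L" by (simp add: compact_eq_bounded_closed)
  have ne: "L \<noteq> {}" using x0 L[of x0] by (auto simp: M_def)
  have "continuous_on (interior K) F"
    by (rule has_derivative_continuous_on[OF has_derivative_at_withinI[OF primal.f_deriv]])
  then have cont: "continuous_on L (\<lambda>x. s \<bullet> x + F x)"
    by (intro continuous_intros) (auto simp: L intro: continuous_on_subset)
  from continuous_attains_inf[OF comp ne cont] obtain x where
    x: "x \<in> L" "\<forall>y\<in>L. s \<bullet> x + F x \<le> s \<bullet> y + F y" by (elim bexE)
  have min: "s \<bullet> x + F x \<le> s \<bullet> y + F y" if "y \<in> interior K" for y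
  proof (cases "y \<in> L")
    case False
    then show ?thesis using x(1) that by (auto simp: L)
  qed (use x in blast)
  have xK: "x \<in> interior K" using x(1) L by blast
  have "((\<lambda>x. s \<bullet> x + F x) has_derivative (\<lambda>h. s \<bullet> h + grad F x \<bullet> h)) (at x)"
    by (auto intro!: derivative_eq_intros primal.f_deriv[OF xK])
  from differential_zero_maxmin[OF xK open_interior this] min
  have "(\<lambda>h. s \<bullet> h + grad F x \<bullet> h) = (\<lambda>h. 0)" by blast
  then have "(grad F x + s) \<bullet> (grad F x + s) = 0" by (metis inner_add_left add.commute)
  then have "grad F x = - s" by (simp add: eq_neg_iff_add_eq_0)
  then show ?thesis using xK by blast
qed

text \<open>
  For \<open>s\<close> in the interior of the dual cone, the convex function \<open>\<langle>s, x\<rangle> + F x\<close> is minimal where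
  \<open>\<nabla>F x = - s\<close>, so this point attains the supremum that defines the dual barrier.
\<close>

definition dual_maximizer :: "'a \<Rightarrow> 'a" where
  "dual_maximizer s = the_inv_into (interior K) (grad F) (- s)"

lemma dual_maximizer_grad: "x \<in> interior K \<Longrightarrow> dual_maximizer (- grad F x) = x"
  unfolding dual_maximizer_def using the_inv_into_f_f[OF primal.gradient_inj_on] by simp

lemma dual_maximizer:
  assumes "s \<in> interior (dual_cone K)"
  shows "dual_maximizer s \<in> interior K" "grad F (dual_maximizer s) = - s"
  using dual_maximizer_exists[OF assms] dual_maximizer_grad by force+

lemma dual_barrier_eq:
  assumes s: "s \<in> interior (dual_cone K)"
  shows "dual_barrier K F s = - (s \<bullet> dual_maximizer s) - F (dual_maximizer s)"
  unfolding dual_barrier_def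
proof (rule cSup_eq_maximum)
  show "- (s \<bullet> dual_maximizer s) - F (dual_maximizer s) \<in> (\<lambda>x. - (s \<bullet> x) - F x) ` interior K"
    using dual_maximizer(1)[OF s] by blast
  fix v assume "v \<in> (\<lambda>x. - (s \<bullet> x) - F x) ` interior K"
  then obtain y where y: "y \<in> interior K" "v = - (s \<bullet> y) - F y" by blast
  show "v \<le> - (s \<bullet> dual_maximizer s) - F (dual_maximizer s)"
    using sc_gradient_inequality[OF sc dual_maximizer(1)[OF s] y(1)] y(2)
    by (simp add: dual_maximizer(2)[OF s] inner_diff_right)
qed

abbreviation dual_hess :: "'a \<Rightarrow> 'a \<Rightarrow> 'a" where
  "dual_hess s \<equiv> inv (hess F (dual_maximizer s))"

lemma dual_maximizer_deriv:
  assumes s: "s \<in> interior (dual_cone K)"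
  shows "(dual_maximizer has_derivative (\<lambda>d. - dual_hess s d)) (at s)"
proof (rule has_derivative_inverse_strong_x[where f = "\<lambda>x. - grad F x" and S = "interior K"])
  note M = primal.H_pos[OF dual_maximizer(1)[OF s]]
  show "continuous_on (interior K) (\<lambda>x. - grad F x)"
    by (intro continuous_intros has_derivative_continuous_on[OF has_derivative_at_withinI[OF primal.g_deriv]])
  show "((\<lambda>x. - grad F x) has_derivative (\<lambda>h. - hess F (dual_maximizer s) h)) (at (dual_maximizer s))"
    by (intro has_derivative_minus primal.g_deriv dual_maximizer s)
  show "(\<lambda>h. - hess F (dual_maximizer s) h) \<circ> (\<lambda>d. - dual_hess s d) = id"
    using linear_neg[OF pos_def_op_linear[OF M]] by (auto simp: pos_def_op_inv(1)[OF M])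
qed (use s dual_maximizer dual_maximizer_grad in auto)

lemma dual_barrier_deriv:
  assumes s: "s \<in> interior (dual_cone K)"
  shows "(dual_barrier K F has_derivative (\<lambda>d. - dual_maximizer s \<bullet> d)) (at s)"
proof (rule has_derivative_transform_within_open[OF _ open_interior s])
  let ?x = "dual_maximizer s"
  have "((\<lambda>s. - (s \<bullet> dual_maximizer s) - F (dual_maximizer s)) has_derivative
      (\<lambda>d. - (s \<bullet> - dual_hess s d + d \<bullet> ?x) - grad F ?x \<bullet> (- dual_hess s d))) (at s)"
    by (intro has_derivative_diff has_derivative_minus has_derivative_inner has_derivative_ident
        dual_maximizer_deriv[OF s]
        has_derivative_compose[OF dual_maximizer_deriv[OF s] primal.f_deriv[OF dual_maximizer(1)[OF s]]])
  then show "((\<lambda>s. - (s \<bullet> dual_maximizer s) - F (dual_maximizer s)) has_derivative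
      (\<lambda>d. - dual_maximizer s \<bullet> d)) (at s)"
    by (simp add: dual_maximizer(2)[OF s] inner_commute)
qed (simp add: dual_barrier_eq)

lemma grad_dual_barrier:
  "s \<in> interior (dual_cone K) \<Longrightarrow> grad (dual_barrier K F) s = - dual_maximizer s"
  by (rule grad_eqI[OF dual_barrier_deriv])

lemma dual_gradient_deriv:
  assumes s: "s \<in> interior (dual_cone K)"
  shows "((\<lambda>s. - dual_maximizer s) has_derivative dual_hess s) (at s)"
  using has_derivative_minus[OF dual_maximizer_deriv[OF s]] by simp

lemma hess_dual_barrier:
  assumes s: "s \<in> interior (dual_cone K)"
  shows "hess (dual_barrier K F) s = dual_hess s"
  by (rule hess_eqI, rule has_derivative_transform_within_open[OF dual_gradient_deriv[OF s] open_interior s])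
    (simp add: grad_dual_barrier)

lemma third_deriv_bound:
  assumes x: "x \<in> interior K"
  shows "\<bar>third_deriv F x h h w\<bar> \<le> 2 * local_norm (hess F x) w * (hess F x h \<bullet> h)"
  using primal.third[OF x, of h] has_derivative_unique[OF sc_third_deriv_inner[OF sc x, of h h]] by blast

text \<open>
  The map \<open>\<Psi>(s, h) = (x(s), N(s) h)\<close>, with \<open>N(s)\<close> the inverse Hessian at the maximizer \<open>x(s)\<close>, is the
  inverse of \<open>\<Phi>(x, v) = (- \<nabla>F x, \<nabla>\<^sup>2F x v)\<close>. The inverse function theorem for \<open>\<Phi>\<close> gives the derivative
  of \<open>N(s) h\<close> in \<open>s\<close> without any estimate on inverse operators.
\<close>

lemma dual_hess_form_deriv:
  assumes s: "s \<in> interior (dual_cone K)"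
  shows "((\<lambda>s. dual_hess s h \<bullet> h) has_derivative
    (\<lambda>w. third_deriv F (dual_maximizer s) (dual_hess s h) (dual_hess s h) (dual_hess s w))) (at s)"
proof -
  define x where "x = dual_maximizer s"
  define v where "v = dual_hess s h"
  have x: "x \<in> interior K" using dual_maximizer[OF s] by (simp add: x_def)
  note M = primal.H_pos[OF x]
  note invM = pos_def_op_inv[OF M]
  have lM: "linear (hess F y)" if "y \<in> interior K" for y
    by (rule pos_def_op_linear[OF primal.H_pos[OF that]])
  have lN: "linear (inv (hess F x))" by (rule pos_def_op_linear[OF invM(3)])
  define D where "D = (\<lambda>y u. frechet_derivative (\<lambda>y. hess F y u) (at y))"
  have expand: "hess F y u = (\<Sum>i\<in>Basis. (u \<bullet> i) *\<^sub>R hess F y i)" if "y \<in> interior K" for y u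
  proof -
    have "hess F y u = hess F y (\<Sum>i\<in>Basis. (u \<bullet> i) *\<^sub>R i)" by (simp add: euclidean_representation)
    then show ?thesis using lM[OF that] by (simp add: linear_sum linear_cmul)
  qed
  have apply_deriv: "((\<lambda>p. hess F (fst p) (snd p)) has_derivative
      (\<lambda>p. (\<Sum>i\<in>Basis. (u \<bullet> i) *\<^sub>R D y i (fst p)) + hess F y (snd p))) (at (y, u))"
    if y: "y \<in> interior K" for y u
  proof (rule has_derivative_transform_within_open[of "\<lambda>p. \<Sum>i\<in>Basis. (snd p \<bullet> i) *\<^sub>R hess F (fst p) i" _ _ UNIV "interior K \<times> UNIV"])
    have "((\<lambda>p. hess F (fst p) i) has_derivative (\<lambda>p. D y i (fst p))) (at (y, u))" for i
      using has_derivative_compose[of fst fst "(y, u)" UNIV "\<lambda>y. hess F y i" "D y i"]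
        sc_third_deriv[OF sc y, of i] by (simp add: D_def has_derivative_fst)
    then have "((\<lambda>p. \<Sum>i\<in>Basis. (snd p \<bullet> i) *\<^sub>R hess F (fst p) i) has_derivative
        (\<lambda>p. \<Sum>i\<in>Basis. (snd (y, u) \<bullet> i) *\<^sub>R D y i (fst p) + (snd p \<bullet> i) *\<^sub>R hess F (fst (y, u)) i)) (at (y, u))"
      by (intro has_derivative_sum has_derivative_scaleR has_derivative_inner_left has_derivative_snd has_derivative_ident)
    then show "((\<lambda>p. \<Sum>i\<in>Basis. (snd p \<bullet> i) *\<^sub>R hess F (fst p) i) has_derivative
        (\<lambda>p. (\<Sum>i\<in>Basis. (u \<bullet> i) *\<^sub>R D y i (fst p)) + hess F y (snd p))) (at (y, u))"
      by (simp add: sum.distrib expand[OF y, symmetric])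
    show "open (interior K \<times> (UNIV :: 'a set))" by (intro open_Times) auto
    show "(y, u) \<in> interior K \<times> UNIV" using y by simp
    show "(\<Sum>i\<in>Basis. (snd p \<bullet> i) *\<^sub>R hess F (fst p) i) = hess F (fst p) (snd p)"
      if "p \<in> interior K \<times> UNIV" for p using that expand[of "fst p" "snd p"] by auto
  qed
  (* E a is the derivative of the map y to hess F y v at x in direction a,
     so that its inner products are third derivatives of F. *)
  define E where "E = (\<lambda>a. \<Sum>i\<in>Basis. (v \<bullet> i) *\<^sub>R D x i a)"
  have lD: "linear (D x i)" for i
    using has_derivative_linear[OF sc_third_deriv[OF sc x]] by (simp add: D_def)
  have lE: "linear E" unfolding E_def
    by (intro linear_compose_sum ballI linear_compose_scale_right lD)
  have E_inner: "E a \<bullet> u = third_deriv F x v u a" for a u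
  proof -
    have "third_deriv F x v u a = third_deriv F x (\<Sum>i\<in>Basis. (v \<bullet> i) *\<^sub>R i) u a"
      by (simp add: euclidean_representation)
    also have "\<dots> = (\<Sum>i\<in>Basis. (v \<bullet> i) * third_deriv F x i u a)"
      using sc_third_deriv_linear[OF sc x, of u a] by (simp add: linear_sum[of "\<lambda>v. third_deriv F x v u a"] linear_cmul[of "\<lambda>v. third_deriv F x v u a"])
    also have "\<dots> = E a \<bullet> u"
      by (simp add: E_def inner_sum_left third_deriv_inner[OF sc x] D_def)
    finally show ?thesis by simp
  qed
  define \<Phi> where "\<Phi> = (\<lambda>p. (- grad F (fst p), hess F (fst p) (snd p)))"
  define \<Psi> where "\<Psi> = (\<lambda>q. (dual_maximizer (fst q), dual_hess (fst q) (snd q)))"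
  define \<Psi>' where "\<Psi>' = (\<lambda>q. (- inv (hess F x) (fst q), inv (hess F x) (snd q + E (inv (hess F x) (fst q)))))"
  have \<Phi>_deriv: "(\<Phi> has_derivative (\<lambda>p. (- hess F y (fst p), (\<Sum>i\<in>Basis. (u \<bullet> i) *\<^sub>R D y i (fst p)) + hess F y (snd p)))) (at (y, u))"
    if y: "y \<in> interior K" for y u
    unfolding \<Phi>_def
    by (intro has_derivative_Pair has_derivative_minus apply_deriv y
        has_derivative_compose[of fst fst "(y, u)" UNIV "grad F" "hess F y"] has_derivative_fst has_derivative_ident)
      (simp add: primal.g_deriv[OF y])
  have "(\<Psi> has_derivative \<Psi>') (at (s, h))"
  proof (rule has_derivative_inverse_strong_x[where f = \<Phi> and S = "interior K \<times> UNIV"])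
    show "open (interior K \<times> (UNIV :: 'a set))" by (intro open_Times) auto
    have \<Psi>sh: "\<Psi> (s, h) = (x, v)" by (simp add: \<Psi>_def x_def v_def)
    show "\<Psi> (s, h) \<in> interior K \<times> UNIV" using x by (simp add: \<Psi>sh)
    show "continuous_on (interior K \<times> UNIV) \<Phi>"
      using has_derivative_continuous[OF \<Phi>_deriv] by (auto intro!: continuous_at_imp_continuous_on)
    show "\<Psi> (\<Phi> p) = p" if "p \<in> interior K \<times> UNIV" for p
      using that pos_def_op_inv(2)[OF primal.H_pos] by (auto simp: \<Psi>_def \<Phi>_def dual_maximizer_grad)
    show "(\<Phi> has_derivative (\<lambda>p. (- hess F x (fst p), E (fst p) + hess F x (snd p)))) (at (\<Psi> (s, h)))"
      using \<Phi>_deriv[OF x, of v] by (simp add: \<Psi>sh E_def)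
    show "(\<lambda>p. (- hess F x (fst p), E (fst p) + hess F x (snd p))) \<circ> \<Psi>' = id"
      by (auto simp: \<Psi>'_def linear_neg[OF lM[OF x]] linear_neg[OF lE] invM(1))
    show "\<Phi> (\<Psi> (s, h)) = (s, h)"
      using dual_maximizer(2)[OF s] by (simp add: \<Phi>_def \<Psi>_def invM(1)[unfolded x_def])
  qed
  then have "((\<lambda>s. \<Psi> (s, h)) has_derivative (\<lambda>d. \<Psi>' (d, 0))) (at s)"
    by (rule has_derivative_compose[of "\<lambda>s. (s, h)" "\<lambda>d. (d, 0)" s UNIV, rotated])
      (intro has_derivative_Pair has_derivative_ident has_derivative_const)
  from has_derivative_inner_left[OF has_derivative_snd[OF this], of h]
  have "((\<lambda>s. dual_hess s h \<bullet> h) has_derivative (\<lambda>d. inv (hess F x) (E (inv (hess F x) d)) \<bullet> h)) (at s)"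
    by (simp add: \<Psi>_def \<Psi>'_def)
  moreover have "inv (hess F x) (E (inv (hess F x) d)) \<bullet> h = third_deriv F x v v (inv (hess F x) d)" for d
    unfolding pos_def_op_sym[OF invM(3)] by (simp add: E_inner v_def x_def)
  ultimately show ?thesis by (simp add: v_def x_def)
qed

text \<open>
  The third derivative of the dual barrier at \<open>s\<close> is that of \<open>F\<close> at the maximizer with all
  arguments mapped by the inverse Hessian, which is an isometry between the two local norms.
\<close>

lemma dual_self_concordant_field:
  "self_concordant_field (interior (dual_cone K)) (dual_barrier K F) (\<lambda>s. - dual_maximizer s) dual_hess"
proof
  show "open (interior (dual_cone K))" "convex (interior (dual_cone K))"
    using convex_dual_cone convex_interior by auto
  fix s assume s: "s \<in> interior (dual_cone K)"
  note M = primal.H_pos[OF dual_maximizer(1)[OF s]]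
  note invM = pos_def_op_inv[OF M]
  show "(dual_barrier K F has_derivative (\<lambda>h. - dual_maximizer s \<bullet> h)) (at s)"
    by (rule dual_barrier_deriv[OF s])
  show "((\<lambda>s. - dual_maximizer s) has_derivative dual_hess s) (at s)"
    by (rule dual_gradient_deriv[OF s])
  show "pos_def_op (dual_hess s)" by (rule invM(3))
  fix h
  have "\<bar>third_deriv F (dual_maximizer s) (dual_hess s h) (dual_hess s h) (dual_hess s w)\<bar>
      \<le> 2 * local_norm (dual_hess s) w * (dual_hess s h \<bullet> h)" for w
    using third_deriv_bound[OF dual_maximizer(1)[OF s], of "dual_hess s h" "dual_hess s w"]
      invM(4)[of "dual_hess s w"] by (simp add: invM(1) inner_commute)
  then show "\<exists>D. ((\<lambda>s. dual_hess s h \<bullet> h) has_derivative D) (at s) \<and>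
      (\<forall>w. \<bar>D w\<bar> \<le> 2 * local_norm (dual_hess s) w * (dual_hess s h \<bullet> h))"
    using dual_hess_form_deriv[OF s, of h] by blast
qed

end

sublocale cone_with_normal_barrier \<subseteq> dual: self_concordant_field
  "interior (dual_cone K)" "dual_barrier K F" "\<lambda>s. - dual_maximizer s" dual_hess
  by (rule dual_self_concordant_field)

context cone_with_normal_barrier
begin

lemma dual_dikin:
  assumes s: "s \<in> interior (dual_cone K)" and d: "local_norm (dual_hess s) d < 1"
  shows "s + d \<in> interior (dual_cone K)"
proof (rule dikin_interior_dual_cone[OF primal.H_pos[OF dual_maximizer(1)[OF s]] _ d])
  show "local_norm (hess F (dual_maximizer s)) y \<le> s \<bullet> y" if "y \<in> K" for y
    using hess_norm_le_neg_grad[OF dual_maximizer(1)[OF s] that] by (simp add: dual_maximizer(2)[OF s])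
qed

text \<open>
  The same argument as for the dual, carried out in the cone dual to \<open>K*\<close>, which is \<open>K\<close> again. The
  required domination comes from the recession bound for the dual barrier.
\<close>

lemma primal_dikin:
  assumes x: "x \<in> interior K" and d: "local_norm (hess F x) d < 1"
  shows "x + d \<in> interior K"
proof -
  define s where "s = - grad F x"
  have s: "s \<in> interior (dual_cone K)" and xs: "dual_maximizer s = x"
    using neg_grad_in_interior_dual[OF x] dual_maximizer_grad[OF x] by (auto simp: s_def)
  have M: "pos_def_op (hess F x)" by (rule primal.H_pos[OF x])
  have "x + d \<in> interior (dual_cone (dual_cone K))"
  proof (rule dikin_interior_dual_cone[of "dual_hess s"])
    show "pos_def_op (dual_hess s)" by (rule dual.H_pos[OF s])
    show "local_norm (inv (dual_hess s)) d < 1"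
      using d by (simp add: xs inv_inv_eq[OF pos_def_op_bij[OF M]])
    fix y assume y: "y \<in> dual_cone K"
    have ray: "s + \<theta> *\<^sub>R y \<in> interior (dual_cone K)" if "\<theta> \<ge> 0" for \<theta>
      using that y cone_dual_cone[of K]
      by (intro interior_convex_cone_add[OF convex_dual_cone cone_dual_cone s]) (auto simp: cone_def)
    have "y \<bullet> dual_maximizer (s + \<theta> *\<^sub>R y) \<ge> 0" if "\<theta> \<ge> 0" for \<theta>
      using y dual_maximizer(1)[OF ray[OF that]] interior_subset[of K] by (auto simp: dual_cone_def)
    then show "local_norm (dual_hess s) y \<le> x \<bullet> y"
      using dual.recession_bound[of s y] ray by (simp add: xs inner_commute)
  qed
  moreover have "dual_cone (dual_cone K) = K"
    using interior_K by (intro dual_cone_dual_cone[OF closed_K convex_K cone_K]) auto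
  ultimately show ?thesis by simp
qed

lemma dual_maximizer_scale:
  assumes s: "s \<in> interior (dual_cone K)" and \<tau>: "\<tau> > 0"
  shows "dual_maximizer (\<tau> *\<^sub>R s) = (1 / \<tau>) *\<^sub>R dual_maximizer s"
proof -
  let ?y = "(1 / \<tau>) *\<^sub>R dual_maximizer s"
  have "?y \<in> interior K" using \<tau> by (intro scale_interior dual_maximizer s) auto
  moreover have "- grad F ?y = \<tau> *\<^sub>R s"
    using grad_scale[OF dual_maximizer(1)[OF s], of "1 / \<tau>"] \<tau> by (simp add: dual_maximizer(2)[OF s])
  ultimately show ?thesis using dual_maximizer_grad by metis
qed

lemma dual_hess_scale:
  assumes s: "s \<in> interior (dual_cone K)" and \<tau>: "\<tau> > 0"
  shows "dual_hess (\<tau> *\<^sub>R s) h = (1 / \<tau>\<^sup>2) *\<^sub>R dual_hess s h"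
proof -
  note x = dual_maximizer(1)[OF s]
  note M = primal.H_pos[OF x]
  have ts: "\<tau> *\<^sub>R s \<in> interior (dual_cone K)" by (rule interior_cone_scale[OF cone_dual_cone s \<tau>])
  note M' = primal.H_pos[OF dual_maximizer(1)[OF ts]]
  have "hess F (dual_maximizer (\<tau> *\<^sub>R s)) ((1 / \<tau>\<^sup>2) *\<^sub>R dual_hess s h) = h"
    using \<tau> hess_scale[OF x, of "1 / \<tau>"]
    by (simp add: dual_maximizer_scale[OF s \<tau>] linear_cmul[OF pos_def_op_linear[OF M]]
        pos_def_op_inv(1)[OF M] power_divide)
  then show ?thesis using pos_def_op_inv(2)[OF M'] by metis
qed

end

section \<open>The affine-scaling step\<close>

context cone_with_normal_barrier
begin

lemma interior_nonzero: "x \<in> interior K \<Longrightarrow> x \<noteq> 0"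
  using grad_inner_self[of x] \<nu>_ge_1 by auto

lemma interior_inner_pos:
  assumes "x \<in> interior K" "s \<in> interior (dual_cone K)"
  shows "s \<bullet> x > 0"
proof -
  obtain \<epsilon> where "\<epsilon> > 0" "\<And>x. x \<in> K \<Longrightarrow> \<epsilon> * norm x \<le> s \<bullet> x"
    using assms(2) unfolding mem_interior_dual_cone_iff by blast
  then show ?thesis using interior_nonzero[OF assms(1)] assms(1) interior_subset[of K]
    by (metis mult_pos_pos zero_less_norm_iff less_le_trans subsetD)
qed

lemma dual_hess_self:
  assumes s: "s \<in> interior (dual_cone K)"
  shows "dual_hess s s = dual_maximizer s"
proof -
  note x = dual_maximizer(1)[OF s]
  have "hess F (dual_maximizer s) (dual_maximizer s) = s"
    using hess_self[OF x] by (simp add: dual_maximizer(2)[OF s])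
  then show ?thesis using pos_def_op_inv(2)[OF primal.H_pos[OF x]] by metis
qed

lemma dual_inner_self:
  assumes s: "s \<in> interior (dual_cone K)"
  shows "dual_maximizer s \<bullet> s = \<nu>"
  using grad_inner_self[OF dual_maximizer(1)[OF s]]
  by (simp add: dual_maximizer(2)[OF s] inner_commute)

lemma dual_norm_self:
  assumes s: "s \<in> interior (dual_cone K)"
  shows "local_norm (dual_hess s) s = sqrt \<nu>"
  by (simp add: local_norm_def dual_hess_self[OF s] dual_inner_self[OF s])

text \<open>
  Both identities are the Pythagorean theorem: \<open>U\<close> and \<open>N V\<close>, with \<open>N\<close> the inverse of \<open>M\<close>, are
  \<open>M\<close>-orthogonal with sum \<open>- N p\<close>, so their sum and their difference have the same norm.
\<close>

lemma affine_scaling_norms: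
  assumes M: "pos_def_op M" and dir: "V + M U = - p" and orth: "V \<bullet> U = 0"
  shows "(local_norm M U)\<^sup>2 + (local_norm (inv M) V)\<^sup>2 = (local_norm (inv M) p)\<^sup>2"
    and "local_norm M (inv M V - U) = local_norm (inv M) p"
proof -
  note N = pos_def_op_inv(3)[OF M]
  note lM = pos_def_op_linear[OF M] and lN = pos_def_op_linear[OF N]
  have p: "p = - (V + M U)" using dir by simp
  have 1: "inv M V \<bullet> M U = 0" "U \<bullet> V = 0"
    using pos_def_op_sym[OF N, of V "M U"] orth by (simp_all add: pos_def_op_inv(2)[OF M] inner_commute)
  have "inv M p \<bullet> p = inv M V \<bullet> V + M U \<bullet> U"
    using 1 by (simp add: p linear_neg[OF lN] linear_add[OF lN] linear_diff[OF lN] pos_def_op_inv(2)[OF M]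
        inner_add_left inner_add_right inner_diff_left inner_diff_right inner_commute[of U])
  then show pyth: "(local_norm M U)\<^sup>2 + (local_norm (inv M) V)\<^sup>2 = (local_norm (inv M) p)\<^sup>2"
    by (simp add: local_norm_square[OF M] local_norm_square[OF N])
  have "M (inv M V - U) \<bullet> (inv M V - U) = inv M V \<bullet> V + M U \<bullet> U"
    using 1 orth by (simp add: linear_diff[OF lM] pos_def_op_inv(1)[OF M]
        inner_diff_left inner_diff_right inner_commute[of V] inner_commute[of "M U" "inv M V"])
  then show "local_norm M (inv M V - U) = local_norm (inv M) p"
    using \<open>inv M p \<bullet> p = _\<close> by (simp add: local_norm_def)
qed

text \<open>
  Splitting \<open>U\<close> and \<open>V\<close> into halves of sum and difference keeps the constant sharp. The halves of the
  sum are multiples of \<open>X\<close> and \<open>p\<close> and are evaluated exactly by Euler's identity; the halves of the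
  difference meet only the second-order errors of the two gradients.
\<close>

lemma affine_scaling_slope:
  fixes s \<delta> U V :: 'a
  assumes s: "s \<in> interior (dual_cone K)"
  defines "N \<equiv> dual_hess s" and "M \<equiv> hess F (dual_maximizer s)"
  defines "l \<equiv> local_norm N \<delta>"
  assumes l: "l < 1"
    and dir: "V + M U = - (s + \<delta>)" and orth: "V \<bullet> U = 0"
  shows "grad F (N (s + \<delta>)) \<bullet> U - dual_maximizer (s + \<delta>) \<bullet> V
    \<le> \<nu> + l\<^sup>2 / (1 - l) * local_norm N (s + \<delta>)"
proof -
  define x where "x = dual_maximizer s"
  have x: "x \<in> interior K" and gx: "grad F x = - s" using dual_maximizer[OF s] by (auto simp: x_def)
  have M: "pos_def_op M" unfolding M_def by (rule primal.H_pos[OF x[unfolded x_def]])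
  have N_eq: "N = inv M" by (simp add: N_def M_def)
  have N: "pos_def_op N" unfolding N_eq by (rule pos_def_op_inv(3)[OF M])
  note MN = pos_def_op_inv(1)[OF M, folded N_eq] and NM = pos_def_op_inv(2)[OF M, folded N_eq]
  note lM = pos_def_op_linear[OF M] and lN = pos_def_op_linear[OF N]
  have Ns: "N s = x" unfolding N_def x_def by (rule dual_hess_self[OF s])
  define p where "p = s + \<delta>"
  define X where "X = N p"
  have X: "X = x + N \<delta>" by (simp add: X_def p_def linear_add[OF lN] Ns)
  have l1: "local_norm M (N \<delta>) = l"
    using pos_def_op_inv(4)[OF M, of "N \<delta>"] by (simp add: MN l_def N_eq[symmetric])
  have XK: "X \<in> interior K"
    unfolding X by (rule primal_dikin[OF x]) (use l l1 in \<open>simp add: M_def x_def\<close>)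
  have pK: "p \<in> interior (dual_cone K)"
    unfolding p_def by (rule dual_dikin[OF s]) (use l in \<open>simp add: l_def N_def\<close>)
  define gX where "gX = grad F X"
  define gp where "gp = - dual_maximizer p"
  define q where "q = N V - U"
  have Mq: "M q = V - M U" by (simp add: q_def linear_diff[OF lM] MN)
  have nq: "local_norm M q = local_norm N p"
    using affine_scaling_norms(2)[OF M dir orth] by (simp add: q_def p_def N_eq)
  have nMq: "local_norm N (M q) = local_norm N p" using pos_def_op_inv(4)[OF M, of q] nq by (simp add: N_eq)
  define \<rho> where "\<rho> = l\<^sup>2 / (1 - l)"
  have ex: "\<bar>(gX + s - \<delta>) \<bullet> q\<bar> \<le> \<rho> * local_norm N p"
    using primal.gradient_linearization_error[of x "N \<delta>" q] x XK l l1
    by (simp add: X gX_def gx MN x_def[symmetric] M_def[symmetric, folded x_def] nq \<rho>_def)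
  have ep: "\<bar>(gp + x - N \<delta>) \<bullet> M q\<bar> \<le> \<rho> * local_norm N p"
    using dual.gradient_linearization_error[of s \<delta> "M q"] s pK l nMq
    by (simp add: gp_def p_def x_def N_def[symmetric] l_def \<rho>_def)
  have U2: "2 *\<^sub>R U = - X - q"
  proof -
    have "N (V + M U) = - X" by (simp add: dir p_def[symmetric] X_def linear_neg[OF lN])
    then have "N V + U = - X" by (simp add: linear_add[OF lN] NM)
    then have "X = - (N V + U)" by simp
    then show ?thesis by (simp add: q_def scaleR_2)
  qed
  have V2: "2 *\<^sub>R V = - p + M q"
    unfolding p_def dir[symmetric] by (simp add: Mq scaleR_2)
  (* The zeroth and first-order terms of the two gradients cancel against each other. *)
  have "x \<bullet> M q = s \<bullet> q"
    using pos_def_op_sym[OF M, of x q] hess_self[OF x] by (simp add: M_def x_def[symmetric] gx)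
  moreover have "N \<delta> \<bullet> M q = \<delta> \<bullet> q" using pos_def_op_sym[OF M, of "N \<delta>" q] by (simp add: MN)
  ultimately have diff: "gX \<bullet> q - gp \<bullet> M q = (gX + s - \<delta>) \<bullet> q - (gp + x - N \<delta>) \<bullet> M q"
    by (simp add: inner_add_left inner_diff_left)
  have "2 * (gX \<bullet> U + gp \<bullet> V) = gX \<bullet> (2 *\<^sub>R U) + gp \<bullet> (2 *\<^sub>R V)" by simp
  also have "\<dots> = - (gX \<bullet> X) - gp \<bullet> p - (gX \<bullet> q - gp \<bullet> M q)"
    unfolding U2 V2 by (simp add: inner_diff_right inner_add_right)
  also have "gX \<bullet> X = - \<nu>" unfolding gX_def by (rule grad_inner_self[OF XK])
  also have "gp \<bullet> p = - \<nu>" by (simp add: gp_def dual_inner_self[OF pK])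
  finally have "2 * (gX \<bullet> U + gp \<bullet> V) = 2 * \<nu> - (gX \<bullet> q - gp \<bullet> M q)" by simp
  moreover have "- (gX \<bullet> q - gp \<bullet> M q) \<le> 2 * (\<rho> * local_norm N p)"
    unfolding diff using abs_le_D2[OF ex] abs_le_D1[OF ep] by simp
  ultimately have "gX \<bullet> U + gp \<bullet> V \<le> \<nu> + \<rho> * local_norm N p" by simp
  then show ?thesis by (simp add: gX_def gp_def X_def p_def \<rho>_def)
qed

text \<open>
  The estimates of the theorem for primal points scaled by \<open>t\<close>. Besides the slope bound, it uses that the
  direction has joint local norm at most \<open>c\<close> at the starting pair, which also keeps both components of
  the step inside their Dikin ellipsoids.
\<close>

lemma affine_scaling_step:
  fixes s \<delta> U V :: 'a
  assumes s: "s \<in> interior (dual_cone K)"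
  defines "N \<equiv> dual_hess s" and "M \<equiv> hess F (dual_maximizer s)"
  assumes close: "local_norm N \<delta> \<le> \<beta>" and \<beta>: "\<beta> < 1"
    and dir: "V + M U = - (s + \<delta>)" and orth: "V \<bullet> U = 0"
    and c: "c = (sqrt \<nu> + \<beta>) / (1 - \<beta>)" and \<alpha>: "\<alpha> \<ge> 0" "\<alpha> * c < 1"
  defines "p \<equiv> s + \<delta>"
  defines "X \<equiv> N p"
  shows "X \<in> interior K" "p \<in> interior (dual_cone K)"
    and "X + \<alpha> *\<^sub>R U \<in> interior K" "p + \<alpha> *\<^sub>R V \<in> interior (dual_cone K)"
    and "\<nu> * ln ((p + \<alpha> *\<^sub>R V) \<bullet> (X + \<alpha> *\<^sub>R U)) + F (X + \<alpha> *\<^sub>R U) + dual_barrier K F (p + \<alpha> *\<^sub>R V)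
      \<le> \<nu> * ln (p \<bullet> X) + F X + dual_barrier K F p + \<alpha> * c * \<beta>\<^sup>2 + omega_star (\<alpha> * c) - \<nu> * omega_star \<alpha>"
proof -
  define x where "x = dual_maximizer s"
  have x: "x \<in> interior K" using dual_maximizer[OF s] by (auto simp: x_def)
  have M: "pos_def_op M" unfolding M_def by (rule primal.H_pos[OF x[unfolded x_def]])
  have N_eq: "N = inv M" by (simp add: N_def M_def)
  have N: "pos_def_op N" unfolding N_eq by (rule pos_def_op_inv(3)[OF M])
  note MN = pos_def_op_inv(1)[OF M, folded N_eq] and NM = pos_def_op_inv(2)[OF M, folded N_eq]
  note lM = pos_def_op_linear[OF M] and lN = pos_def_op_linear[OF N]
  define l where "l = local_norm N \<delta>"
  have l: "0 \<le> l" "l \<le> \<beta>" "l < 1" using close \<beta> local_norm_nonneg[OF N] by (auto simp: l_def)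
  have X: "X = x + N \<delta>"
    using dual_hess_self[OF s, folded N_def x_def] by (simp add: X_def p_def linear_add[OF lN])
  have l1: "local_norm M (N \<delta>) = l"
    using pos_def_op_inv(4)[OF M, of "N \<delta>"] by (simp add: MN l_def N_eq[symmetric])
  show XK: "X \<in> interior K"
    unfolding X by (rule primal_dikin[OF x]) (use l l1 in \<open>simp add: M_def x_def\<close>)
  show pK: "p \<in> interior (dual_cone K)"
    unfolding p_def by (rule dual_dikin[OF s]) (use l in \<open>simp add: l_def N_def\<close>)
  define n where "n = local_norm N p"
  have n: "0 \<le> n" "n \<le> sqrt \<nu> + l"
    using local_norm_triangle[OF N, of s \<delta>] dual_norm_self[OF s] local_norm_nonneg[OF N]
    by (auto simp: n_def p_def l_def N_def)
  have \<nu>: "sqrt \<nu> \<ge> 1" using \<nu>_ge_1 by simp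
  (* The joint local norm at (X, p) is at most the one at (x, s) divided by 1 - l. *)
  have nc: "n / (1 - l) \<le> c"
    unfolding c using n l \<beta> \<nu> by (intro frac_le) auto
  have "1 - \<beta> \<le> sqrt \<nu> + \<beta>" using \<nu> l by linarith
  then have c1: "c \<ge> 1" using \<beta> by (simp add: c pos_le_divide_eq)
  have \<alpha>1: "\<alpha> < 1"
  proof -
    have "\<alpha> * 1 \<le> \<alpha> * c" using c1 \<alpha> by (intro mult_left_mono) auto
    then show ?thesis using \<alpha> by simp
  qed
  define r1 where "r1 = local_norm (hess F X) U"
  define r2 where "r2 = local_norm (dual_hess p) V"
  have r0: "r1 \<ge> 0" "r2 \<ge> 0"
    using local_norm_nonneg[OF primal.H_pos[OF XK]] local_norm_nonneg[OF dual.H_pos[OF pK]] by (auto simp: r1_def r2_def)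
  have r1: "r1 \<le> local_norm M U / (1 - l)"
    using primal.local_norm_comparison[of x "N \<delta>" U] x XK l l1
    by (simp add: r1_def X M_def x_def)
  have r2: "r2 \<le> local_norm N V / (1 - l)"
    using dual.local_norm_comparison[of s \<delta> V] s pK l
    by (simp add: r2_def p_def N_def l_def)
  have "r1\<^sup>2 + r2\<^sup>2 \<le> (local_norm M U / (1 - l))\<^sup>2 + (local_norm N V / (1 - l))\<^sup>2"
    using r0 r1 r2 by (intro add_mono power_mono)
  also have "\<dots> = (n / (1 - l))\<^sup>2"
    using affine_scaling_norms(1)[OF M dir orth]
    by (simp add: power_divide n_def p_def N_eq add_divide_distrib[symmetric])
  also have "\<dots> \<le> c\<^sup>2" using nc n l by (intro power_mono) auto
  finally have r12: "r1\<^sup>2 + r2\<^sup>2 \<le> c\<^sup>2" .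
  have "r1\<^sup>2 \<le> c\<^sup>2" "r2\<^sup>2 \<le> c\<^sup>2" using r12 zero_le_power2[of r1] zero_le_power2[of r2] by linarith+
  then have "r1 \<le> c" "r2 \<le> c" using c1 by (auto intro: power2_le_imp_le)
  then have ar: "\<alpha> * r1 < 1" "\<alpha> * r2 < 1"
    using \<alpha> by (auto intro: le_less_trans[OF mult_left_mono])
  have n1: "local_norm (hess F X) (\<alpha> *\<^sub>R U) = \<alpha> * r1" "local_norm (dual_hess p) (\<alpha> *\<^sub>R V) = \<alpha> * r2"
    using \<alpha> local_norm_scaleR[OF primal.H_pos[OF XK]] local_norm_scaleR[OF dual.H_pos[OF pK]]
    by (auto simp: r1_def r2_def)
  show XU: "X + \<alpha> *\<^sub>R U \<in> interior K" by (rule primal_dikin[OF XK]) (simp add: n1 ar)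
  show pV: "p + \<alpha> *\<^sub>R V \<in> interior (dual_cone K)" by (rule dual_dikin[OF pK]) (simp add: n1 ar)
  have up1: "F (X + \<alpha> *\<^sub>R U) \<le> F X + \<alpha> * (grad F X \<bullet> U) + omega_star (\<alpha> * r1)"
    using primal.upper_bound[OF XK XU] by (simp add: n1 ar)
  have up2: "dual_barrier K F (p + \<alpha> *\<^sub>R V)
      \<le> dual_barrier K F p - \<alpha> * (dual_maximizer p \<bullet> V) + omega_star (\<alpha> * r2)"
    using dual.upper_bound[OF pK pV] by (simp add: n1 ar)
  have om: "omega_star (\<alpha> * r1) + omega_star (\<alpha> * r2) \<le> omega_star (\<alpha> * c)"
  proof (rule omega_star_superadditive)
    show "(\<alpha> * r1)\<^sup>2 + (\<alpha> * r2)\<^sup>2 \<le> (\<alpha> * c)\<^sup>2"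
      using mult_left_mono[OF r12, of "\<alpha>\<^sup>2"] by (simp add: power_mult_distrib distrib_left)
  qed (use r0 \<alpha> c1 in auto)
  have "grad F X \<bullet> U - dual_maximizer p \<bullet> V \<le> \<nu> + l\<^sup>2 / (1 - l) * n"
    using affine_scaling_slope[OF s, of \<delta> V U] l dir orth
    by (simp add: X_def p_def n_def N_def M_def l_def)
  also have "l\<^sup>2 / (1 - l) * n = l\<^sup>2 * (n / (1 - l))" by simp
  also have "\<dots> \<le> \<beta>\<^sup>2 * c" using nc n l by (intro mult_mono power_mono) auto
  finally have slope: "grad F X \<bullet> U - dual_maximizer p \<bullet> V \<le> \<nu> + c * \<beta>\<^sup>2" by (simp add: mult.commute)
  have "\<alpha> * (grad F X \<bullet> U) - \<alpha> * (dual_maximizer p \<bullet> V) \<le> \<alpha> * \<nu> + \<alpha> * c * \<beta>\<^sup>2"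
    using mult_left_mono[OF slope \<alpha>(1)] by (simp add: right_diff_distrib distrib_left mult.assoc)
  moreover have "\<nu> * ln ((p + \<alpha> *\<^sub>R V) \<bullet> (X + \<alpha> *\<^sub>R U)) = \<nu> * ln (1 - \<alpha>) + \<nu> * ln (p \<bullet> X)"
  proof -
    have "N (V + M U) = - X" by (simp add: dir p_def[symmetric] X_def linear_neg[OF lN])
    then have "N V + U = - X" by (simp add: linear_add[OF lN] NM)
    then have "p \<bullet> (N V + U) = - (p \<bullet> X)" by simp
    moreover have "p \<bullet> N V = V \<bullet> X" using pos_def_op_sym[OF N, of p V] by (simp add: X_def inner_commute)
    ultimately have "V \<bullet> X + p \<bullet> U = - (p \<bullet> X)" by (simp add: inner_add_right)
    then have "\<alpha> * (V \<bullet> X) + \<alpha> * (p \<bullet> U) = - \<alpha> * (p \<bullet> X)" by (metis distrib_left mult_minus_left mult_minus_right)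
    then have "(p + \<alpha> *\<^sub>R V) \<bullet> (X + \<alpha> *\<^sub>R U) = (1 - \<alpha>) * (p \<bullet> X)"
      using orth by (simp add: inner_add_left inner_add_right left_diff_distrib)
    then show ?thesis using \<alpha>1 interior_inner_pos[OF XK pK] by (simp add: ln_mult distrib_left)
  qed
  moreover have "- \<nu> * omega_star \<alpha> = \<nu> * \<alpha> + \<nu> * ln (1 - \<alpha>)"
    by (simp add: omega_star_def algebra_simps)
  ultimately show "\<nu> * ln ((p + \<alpha> *\<^sub>R V) \<bullet> (X + \<alpha> *\<^sub>R U)) + F (X + \<alpha> *\<^sub>R U) + dual_barrier K F (p + \<alpha> *\<^sub>R V)
      \<le> \<nu> * ln (p \<bullet> X) + F X + dual_barrier K F p + \<alpha> * c * \<beta>\<^sup>2 + omega_star (\<alpha> * c) - \<nu> * omega_star \<alpha>"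
    using up1 up2 om by (simp add: mult.commute[of \<nu> \<alpha>])
qed

text \<open>
  The proximity measure is invariant under scaling of the primal point: the change \<open>\<nu> ln t\<close> of the
  barrier cancels that of the inner product.
\<close>

lemma proximity_scale:
  assumes x: "x \<in> interior K" and s: "s \<in> interior (dual_cone K)" and t: "t > 0"
  shows "proximity \<nu> K F ((1 / t) *\<^sub>R x, y, s)
    = \<nu> * ln (s \<bullet> x) + F x + dual_barrier K F s + \<nu> - \<nu> * ln \<nu>"
  using log_homogeneous[OF x, of "1 / t"] interior_inner_pos[OF x s] t
  by (simp add: proximity_def ln_div algebra_simps)

text \<open>
  Prolonging the segment from \<open>y0\<close> through \<open>y\<close> stays feasible for a short while, which makes the
  slack at \<open>y\<close> a proper convex combination of an interior point and a point of the cone.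
\<close>

lemma dual_slack_interior:
  assumes A: "linear (adjoint A)" and y: "y \<in> interior (dual_feasible_set K A c)"
    and y0: "c - adjoint A y0 \<in> interior (dual_cone K)"
  shows "c - adjoint A y \<in> interior (dual_cone K)"
proof -
  obtain e where e: "e > 0" "cball y e \<subseteq> dual_feasible_set K A c"
    using y by (meson mem_interior_cball)
  define \<eta> where "\<eta> = e / (norm (y - y0) + 1)"
  have \<eta>: "\<eta> > 0" using e by (simp add: \<eta>_def add_nonneg_pos)
  have "\<eta> * norm (y - y0) \<le> e"
    using e by (simp add: \<eta>_def pos_divide_le_eq add_nonneg_pos mult_left_mono)
  then have "y + \<eta> *\<^sub>R (y - y0) \<in> cball y e" using \<eta> by (simp add: dist_norm)
  then have "c - adjoint A (y + \<eta> *\<^sub>R (y - y0)) \<in> dual_cone K"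
    using e(2) unfolding dual_feasible_set_def by blast
  then have "\<eta> *\<^sub>R (c - adjoint A y0) + (c - adjoint A (y + \<eta> *\<^sub>R (y - y0))) \<in> interior (dual_cone K)"
    by (intro interior_convex_cone_add[OF convex_dual_cone cone_dual_cone]
        interior_cone_scale[OF cone_dual_cone] y0 \<eta>)
  moreover have "\<eta> *\<^sub>R (c - adjoint A y0) + (c - adjoint A (y + \<eta> *\<^sub>R (y - y0))) = (1 + \<eta>) *\<^sub>R (c - adjoint A y)"
    by (simp add: linear_add[OF A] linear_cmul[OF A] linear_diff[OF A] algebra_simps)
  ultimately have "(1 + \<eta>) *\<^sub>R (c - adjoint A y) \<in> interior (dual_cone K)" by (simp only:)
  then have "(1 / (1 + \<eta>)) *\<^sub>R ((1 + \<eta>) *\<^sub>R (c - adjoint A y)) \<in> interior (dual_cone K)"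
    by (rule interior_cone_scale[OF cone_dual_cone]) (use \<eta> in simp)
  moreover have "1 + \<eta> \<noteq> 0" using \<eta> by simp
  ultimately show ?thesis by simp
qed

lemma dual_barrier_y_derivatives:
  fixes A :: "'a \<Rightarrow> real ^ 'm"
  assumes A: "linear A" and y: "c - adjoint A y \<in> interior (dual_cone K)"
  shows "(dual_barrier_y K F A c has_derivative (\<lambda>h. A (dual_maximizer (c - adjoint A y)) \<bullet> h)) (at y)"
    and "hess (dual_barrier_y K F A c) y = (\<lambda>h. A (dual_hess (c - adjoint A y) (adjoint A h)))"
proof -
  note lA = adjoint_linear[OF A]
  let ?s = "\<lambda>y. c - adjoint A y"
  have s': "(?s has_derivative (\<lambda>h. - adjoint A h)) (at y)" for y
    using has_derivative_diff[OF has_derivative_const linear_imp_has_derivative[OF lA]] by fastforce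
  have der: "(dual_barrier_y K F A c has_derivative (\<lambda>h. A (dual_maximizer (?s y)) \<bullet> h)) (at y)"
    if "?s y \<in> interior (dual_cone K)" for y
    using has_derivative_compose[OF s' dual.f_deriv[OF that]]
    unfolding dual_barrier_y_def[abs_def] by (simp add: adjoint_works[OF A] linear_neg[OF A])
  then show "(dual_barrier_y K F A c has_derivative (\<lambda>h. A (dual_maximizer (?s y)) \<bullet> h)) (at y)"
    using y by blast
  have opn: "open (?s -` interior (dual_cone K))"
    by (rule open_vimage[OF open_interior]) (rule has_derivative_continuous_on[OF has_derivative_at_withinI[OF s']])
  have "((\<lambda>y. dual_maximizer (?s y)) has_derivative (\<lambda>h. dual_hess (?s y) (adjoint A h))) (at y)"
    using has_derivative_compose[OF s' dual_maximizer_deriv[OF y]]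
    by (simp add: linear_neg[OF pos_def_op_linear[OF dual.H_pos[OF y]]])
  then have "((\<lambda>y. A (dual_maximizer (?s y))) has_derivative (\<lambda>h. A (dual_hess (?s y) (adjoint A h)))) (at y)"
    by (rule has_derivative_compose[OF _ linear_imp_has_derivative[OF A]])
  then have "(grad (dual_barrier_y K F A c) has_derivative (\<lambda>h. A (dual_hess (?s y) (adjoint A h)))) (at y)"
    by (rule has_derivative_transform_within_open[OF _ opn]) (use y grad_eqI[OF der] in auto)
  then show "hess (dual_barrier_y K F A c) y = (\<lambda>h. A (dual_hess (?s y) (adjoint A h)))"
    by (rule hess_eqI)
qed

end

section \<open>One affine-scaling step after the dual gambit rule\<close>

theorem theorem2:
  fixes K :: "'a::euclidean_space set"
    and F :: "'a \<Rightarrow> real"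
    and A :: "'a \<Rightarrow> real^'m"
    and b :: "real^'m" and c :: 'a
    and \<nu> t \<beta> lam c\<^sub>\<beta> \<alpha> :: real
    and ybar dbar yhat :: "real^'m"
    and sbar xbar shat wsbar xhat wbar :: 'a
    and zhat \<Delta>z :: "'a \<times> (real^'m) \<times> 'a"
    and z :: "real \<Rightarrow> 'a \<times> (real^'m) \<times> 'a"
  assumes "closed K" and "convex K" and "cone K"
    and "\<forall>x. x \<in> K \<and> - x \<in> K \<longrightarrow> x = 0"
    and "interior K \<noteq> {}"
    and "normal_barrier \<nu> K F"
    and "linear A" and "b \<noteq> 0"
    and "inj (\<lambda>(y :: real^'m, \<tau> :: real). adjoint A y + \<tau> *\<^sub>R c)"
    and "\<exists>ztilde. strictly_feasible K A b c ztilde"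
    and "t > 0"
    and "ybar \<in> interior (dual_feasible_set K A c)"
    and "dbar = inv (hess (dual_barrier_y K F A c) ybar) (grad (dual_potential K F A b c t) ybar)"
    and "lam = sqrt (grad (dual_potential K F A b c t) ybar \<bullet>
           inv (hess (dual_barrier_y K F A c) ybar) (grad (dual_potential K F A b c t) ybar))"
    and "lam \<le> \<beta>" and "\<beta> < 1"
    and "sbar = c - adjoint A ybar"
    and "xbar = - (1 / t) *\<^sub>R grad (dual_barrier K F) sbar"
    and "yhat = ybar + dbar"
    and "shat = c - adjoint A yhat"
    and "wsbar = sqrt t *\<^sub>R sbar"
    and "xhat = hess (dual_barrier K F) wsbar shat"
    and "zhat = (xhat, yhat, shat)"
    and "wbar = sqrt t *\<^sub>R xbar"
    and "affine_scaling_direction F A wbar shat \<Delta>z"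
    and "c\<^sub>\<beta> = (sqrt \<nu> + \<beta>) / (1 - \<beta>)"
    and "\<And>a. z a = zhat + a *\<^sub>R \<Delta>z"
    and "\<alpha> \<ge> 0" and "\<alpha> * c\<^sub>\<beta> < 1"
  shows "strictly_feasible K A b c zhat \<and>
         strictly_feasible K A b c (z \<alpha>) \<and>
         proximity \<nu> K F (z \<alpha>) \<le>
           proximity \<nu> K F zhat + \<alpha> * c\<^sub>\<beta> * \<beta>\<^sup>2 + omega_star (\<alpha> * c\<^sub>\<beta>) - \<nu> * omega_star \<alpha> \<and>
         proximity \<nu> K F zhat + \<alpha> * c\<^sub>\<beta> * \<beta>\<^sup>2 + omega_star (\<alpha> * c\<^sub>\<beta>) - \<nu> * omega_star \<alpha> \<le>
           proximity \<nu> K F zhat - ln (1 - \<alpha> * c\<^sub>\<beta>)"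
proof -
  interpret cone_with_normal_barrier \<nu> K F
    using assms(1-6) by unfold_locales
  note A = \<open>linear A\<close> and lA = adjoint_linear[OF \<open>linear A\<close>] and t = \<open>t > 0\<close>
  (* sbar is interior because some strictly feasible dual point exists. *)
  obtain y0 where y0: "c - adjoint A y0 \<in> interior (dual_cone K)"
  proof -
    from assms(10) obtain x0 y0 s0 where "strictly_feasible K A b c (x0, y0, s0)" by auto
    then have "s0 \<in> interior (dual_cone K)" "s0 = c - adjoint A y0"
      by (auto simp: strictly_feasible_def)
    then show ?thesis using that by blast
  qed
  have s: "sbar \<in> interior (dual_cone K)"
    unfolding \<open>sbar = _\<close> by (rule dual_slack_interior[OF lA assms(12) y0])
  define x where "x = dual_maximizer sbar"
  define M where "M = hess F x"
  define N where "N = dual_hess sbar"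
  have xK: "x \<in> interior K" using dual_maximizer(1)[OF s] by (simp add: x_def)
  have M: "pos_def_op M" unfolding M_def by (rule primal.H_pos[OF xK])
  have N: "pos_def_op N" unfolding N_def by (rule dual.H_pos[OF s])
  note lM = pos_def_op_linear[OF M] and lN = pos_def_op_linear[OF N]

  have inj_adj: "y = 0" if "adjoint A y = 0" for y
    using injD[OF assms(9), of "(y, 0)" "(0, 0)"] that linear_0[OF lA] by auto
  define Z where "Z = hess (dual_barrier_y K F A c) ybar"
  have Z: "Z h = A (N (adjoint A h))" for h
    using dual_barrier_y_derivatives(2)[OF A, of c ybar] s by (simp add: Z_def N_def \<open>sbar = _\<close>)
  have Z_inner: "Z h \<bullet> k = N (adjoint A h) \<bullet> adjoint A k" for h k
    by (simp add: Z adjoint_works[OF A])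
  have Z_pos: "pos_def_op Z"
    unfolding pos_def_op_def
  proof (intro conjI allI impI)
    have "Z = A \<circ> (N \<circ> adjoint A)" by (auto simp: Z)
    then show "linear Z" using A lN lA by (auto intro!: linear_compose)
    show "Z u \<bullet> v = u \<bullet> Z v" for u v
      unfolding inner_commute[of u "Z v"] Z_inner pos_def_op_sym[OF N, of "adjoint A u"]
      by (rule inner_commute)
    show "Z h \<bullet> h > 0" if "h \<noteq> 0" for h
      unfolding Z_inner by (rule pos_def_op_pos[OF N]) (use inj_adj that in blast)
  qed
  have grad_\<psi>: "grad (dual_potential K F A b c t) ybar = A x - t *\<^sub>R b"
  proof (rule grad_eqI)
    have "((\<lambda>y. dual_barrier_y K F A c y - t * (b \<bullet> y)) has_derivative (\<lambda>h. A x \<bullet> h - t * (b \<bullet> h))) (at ybar)"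
      using dual_barrier_y_derivatives(1)[OF A, of c ybar] s
      by (auto intro!: derivative_eq_intros simp: x_def \<open>sbar = _\<close>)
    then show "(dual_potential K F A b c t has_derivative (\<lambda>h. (A x - t *\<^sub>R b) \<bullet> h)) (at ybar)"
      by (simp add: dual_potential_def[abs_def] inner_diff_left)
  qed
  have Zd: "Z dbar = A x - t *\<^sub>R b"
    using assms(13) by (simp add: grad_\<psi> Z_def[symmetric] pos_def_op_inv(1)[OF Z_pos])
  define \<delta> where "\<delta> = - adjoint A dbar"
  have shat: "shat = sbar + \<delta>"
    using assms(17,19,20) by (simp add: \<delta>_def linear_add[OF lA])
  have lam: "local_norm N \<delta> = lam"
  proof -
    have "lam = sqrt (Z dbar \<bullet> dbar)"
      using assms(13,14) by (simp add: grad_\<psi> Z_def[symmetric] pos_def_op_inv(1)[OF Z_pos])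
    then show ?thesis by (simp add: Z_inner \<delta>_def local_norm_minus[OF N]) (simp add: local_norm_def)
  qed
  define X where "X = N shat"
  have xhat: "xhat = (1 / t) *\<^sub>R X"
  proof -
    have "wsbar \<in> interior (dual_cone K)"
      unfolding \<open>wsbar = _\<close> using t by (intro interior_cone_scale[OF cone_dual_cone s]) simp
    then show ?thesis
      using assms(22) dual_hess_scale[OF s, of "sqrt t" shat] t
      by (simp add: hess_dual_barrier assms(21) X_def N_def)
  qed
  have wbar: "wbar = (1 / sqrt t) *\<^sub>R x"
  proof -
    have "sqrt t / t = 1 / sqrt t" using t by (simp add: sqrt_divide_self_eq inverse_eq_divide)
    then show ?thesis using assms(18,24) by (simp add: grad_dual_barrier[OF s] x_def)
  qed
  have hess_wbar: "hess F wbar h = t *\<^sub>R M h" for h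
    using hess_scale[OF xK, of "1 / sqrt t" h] t by (simp add: wbar M_def power_divide)
  obtain dx dy ds where dz: "\<Delta>z = (dx, dy, ds)" by (cases \<Delta>z)
  have dir: "ds + t *\<^sub>R M dx = - shat" and Adx: "A dx = 0" and ds: "ds = - adjoint A dy"
    using assms(25) by (auto simp: affine_scaling_direction_def dz hess_wbar eq_neg_iff_add_eq_0)
  (* Multiplying the primal components by t removes t from the equations: the Hessian at wbar is
     t times the one at the maximizer for sbar. *)
  define U where "U = t *\<^sub>R dx"
  have dirU: "ds + M U = - (sbar + \<delta>)" using dir by (simp add: U_def linear_cmul[OF lM] shat)
  have orth: "ds \<bullet> U = 0"
    using adjoint_works[OF A, of dx dy] by (simp add: ds U_def Adx inner_commute)
  note step = affine_scaling_step[OF s, folded N_def, folded x_def, folded M_def, of \<delta> \<beta> ds U c\<^sub>\<beta> \<alpha>,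
      folded shat, folded X_def, OF _ \<open>\<beta> < 1\<close> dirU[folded shat] orth assms(26) \<open>\<alpha> \<ge> 0\<close> \<open>\<alpha> * c\<^sub>\<beta> < 1\<close>]
  have close: "local_norm N \<delta> \<le> \<beta>" using lam \<open>lam \<le> \<beta>\<close> by simp
  note step = step[OF close]
  have lam0: "0 \<le> lam" using local_norm_nonneg[OF N, of \<delta>] lam by simp

  have A_xhat: "A xhat = b"
  proof -
    have "A X = A x + A (N \<delta>)"
      using dual_hess_self[OF s, folded N_def x_def]
      by (simp add: X_def shat linear_add[OF lN] linear_add[OF A])
    also have "A (N \<delta>) = - Z dbar"
      by (simp add: \<delta>_def linear_neg[OF lN] linear_neg[OF A] Z)
    finally show ?thesis using t by (simp add: xhat linear_cmul[OF A] Zd)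
  qed
  have z\<alpha>: "z \<alpha> = ((1 / t) *\<^sub>R (X + \<alpha> *\<^sub>R U), yhat + \<alpha> *\<^sub>R dy, shat + \<alpha> *\<^sub>R ds)"
    using assms(27)[of \<alpha>] t by (simp add: assms(23) dz xhat U_def scaleR_add_right)
  have zhat: "zhat = ((1 / t) *\<^sub>R X, yhat, shat)" by (simp add: assms(23) xhat)
  have feas_hat: "strictly_feasible K A b c zhat"
    using step(1,2) A_xhat t assms(20)
    by (auto simp: strictly_feasible_def zhat xhat intro: scale_interior)
  have feas_\<alpha>: "strictly_feasible K A b c (z \<alpha>)"
  proof -
    have "A ((1 / t) *\<^sub>R (X + \<alpha> *\<^sub>R U)) = b"
      using A_xhat by (simp add: xhat linear_cmul[OF A] linear_add[OF A] U_def Adx)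
    moreover have "shat + \<alpha> *\<^sub>R ds + adjoint A (yhat + \<alpha> *\<^sub>R dy) = c"
      using assms(20) by (simp add: ds linear_add[OF lA] linear_cmul[OF lA])
    ultimately show ?thesis
      using step(3,4) scale_interior[OF step(3), of "1 / t"] t
      by (simp add: strictly_feasible_def z\<alpha>)
  qed
  have descent: "proximity \<nu> K F (z \<alpha>) \<le>
      proximity \<nu> K F zhat + \<alpha> * c\<^sub>\<beta> * \<beta>\<^sup>2 + omega_star (\<alpha> * c\<^sub>\<beta>) - \<nu> * omega_star \<alpha>"
    unfolding z\<alpha> zhat proximity_scale[OF step(3,4) t] proximity_scale[OF step(1,2) t]
    using step(5) by simp
  have "\<alpha> * c\<^sub>\<beta> * \<beta>\<^sup>2 + omega_star (\<alpha> * c\<^sub>\<beta>) - \<nu> * omega_star \<alpha> \<le> - ln (1 - \<alpha> * c\<^sub>\<beta>)"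
  proof -
    have b01: "0 \<le> \<beta>" using lam0 \<open>lam \<le> \<beta>\<close> by simp
    have c1: "c\<^sub>\<beta> \<ge> 1"
    proof -
      have "sqrt \<nu> \<ge> 1" using \<nu>_ge_1 by simp
      then have "1 - \<beta> \<le> sqrt \<nu> + \<beta>" using b01 by linarith
      then show ?thesis using \<open>\<beta> < 1\<close> by (simp add: assms(26) pos_le_divide_eq)
    qed
    have "\<alpha> * 1 \<le> \<alpha> * c\<^sub>\<beta>" using c1 \<open>\<alpha> \<ge> 0\<close> by (intro mult_left_mono)
    then have "\<alpha> < 1" using \<open>\<alpha> * c\<^sub>\<beta> < 1\<close> by simp
    then have "\<nu> * omega_star \<alpha> \<ge> 0" using omega_star_nonneg \<nu>_ge_1 by simp
    moreover have "\<alpha> * c\<^sub>\<beta> * \<beta>\<^sup>2 \<le> \<alpha> * c\<^sub>\<beta> * 1"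
      using b01 \<open>\<beta> < 1\<close> c1 \<open>\<alpha> \<ge> 0\<close> by (intro mult_left_mono) (auto simp: power_le_one)
    ultimately show ?thesis by (simp add: omega_star_def[of "\<alpha> * c\<^sub>\<beta>"])
  qed
  with feas_hat feas_\<alpha> descent show ?thesis by simp
qed

end
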